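(* In the regression setting of the context, let $p\ge 1$ be an integer, let Assumptions 1 and 3 hold, let Assumption 2 hold with $S>p+1$, and suppose $|\varepsilon_i|\le B$ and $V(x)\equiv\sigma^2>0$, where $\sigma,B>0$ are known. Let $\alpha\in(0,1)$, $h=b=n^{-\frac1{2p+3}}$, $g_n=l_n=(\log n/n)^{1/(2p+3)}$, and define $$R^{\mathrm{rbc}}_{\mathrm{EBCI}}(\alpha,h,b)=\sigma\sqrt{2\log(1/\alpha)\sum_{i=1}^n\big(w^{\mathrm{rbc}}_{i,h,b}(0)\big)^2} .$$ Then $$\mathbb P\Big(m(0)\in\big[\hat m^{\mathrm{rbc}}_{g_n,l_n}(0)-R^{\mathrm{rbc}}_{\mathrm{EBCI}}(\alpha,h,b),\ \hat m^{\mathrm{rbc}}_{g_n,l_n}(0)+R^{\mathrm{rbc}}_{\mathrm{EBCI}}(\alpha,h,b)\big]\Big)\ge1-\alpha-\mathrm{CE}_n,$$ where $\mathrm{CE}_n=2\big(\mathbb P(A_n)+\mathbb P(B_n)+\mathbb P(C_n)\big)$ with $$A_n=\Big\{\frac{\max_{i\le n}|w^{\mathrm{rbc}}_{i,g_n,l_n}(0)|}{\sqrt{\sum_{i=1}^n(w^{\mathrm{rbc}}_{i,g_n,l_n}(0))^2}}>\frac{3\sqrt2}{2B\sqrt{\log(2/\alpha)}}\Big\},\quad B_n=\Big\{\frac{|\mathrm{Bias}_{\mathrm{rbc}}|}{\sqrt{\sum_{i=1}^n(w^{\mathrm{rbc}}_{i,g_n,l_n}(0))^2}}>\sqrt{\tfrac{\sigma^2}4\log(\tfrac2\alpha)}\Big\},$$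 $$C_n=\Big\{\frac{\sum_{i=1}^n(w^{\mathrm{rbc}}_{i,g_n,l_n}(0))^2}{\sum_{i=1}^n(w^{\mathrm{rbc}}_{i,h,b}(0))^2}>\frac{\log(1/\alpha)}{4\log(2/\alpha)}\Big\},\quad \mathrm{Bias}_{\mathrm{rbc}}=\sum_{i=1}^nw^{\mathrm{rbc}}_{i,g_n,l_n}(0)\big(m(X_i)-m(0)\big).$$
   Context: Model: $Y_i=m(X_i)+V^{1/2}(X_i)\varepsilon_i$, $i=1,\dots,n$, $\mathbb E[\varepsilon_i|X_i]=0$, $\mathbb E[\varepsilon_i^2|X_i]=1$; target $m(0)$. Assumption 1: the pairs $(X_i,Y_i)$ are mutually independent; the $X_i$ are i.i.d. with values in $[a,b]$ and a Lipschitz continuous density $f_X$ with $\inf_{[a,b]}f_X>0$; $[a,b]=[-1,1]$ (0 interior) or $[0,1]$ (0 boundary). Assumption 2 (order $S$): with $\psi_n=n^{-1/(2S+1)}\log n$, $m$ satisfies $\big|m(\epsilon)-m(0)-\sum_{s=1}^S\frac{m^{(s)}(0)}{s!}\epsilon^s\big|\le M_Sr_S(|\epsilon|)|\epsilon|^S$ for all $|\epsilon|\le\psi_n$ (derivatives one-sided at a boundary point), where $r_S:[0,\infty)\to[0,\infty)$ is nondecreasing with $r_S(t)\to0$ as $t\downarrow0$ and $M_S>0$ is a constant not depending on $n,h$; $m$ is locally Lipschitz at $0$; $V$ is Lipschitz on $[a,b]$ with $V(0)>0$. Assumption 3: for some constant $\varsigma>4+\frac1S$, $\max_{1\le i\le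 n}\mathbb E[|\varepsilon_i|^\varsigma|X_i]\le E_\varsigma<\infty$ a.s., $E_\varsigma$ not depending on $n$. RBC estimator (robust bias correction of the $p$-th order local polynomial estimator): $\hat m^{\mathrm{rbc}}_{h,b}(0)=\sum_{i=1}^nw^{\mathrm{rbc}}_{i,h,b}(0)Y_i$. Let $K$ be a bounded Lipschitz kernel supported on $[-1,1]$ with $\|K\|_\infty\le 1$. For an integer $q$ put $r_q(u)=(1,u,\dots,u^q)^\top$, $\mathbf M_{q,h}=\sum_{j=1}^nK(X_j/h)r_q(X_j/h)r_q^\top(X_j/h)$, and let $\mathbf e_k$ be the unit vector with entry $1$ in the coordinate of $u^k$. Let $\ell_{i,h}=\mathbf e_0^\top\mathbf M_{p,h}^{-1}K(X_i/h)r_p(X_i/h)$ be the order-$p$ local polynomial weights at $0$. The weights are $$w^{\mathrm{rbc}}_{i,h,b}(0)=\ell_{i,h}-\Big(\sum_{j=1}^n\ell_{j,h}X_j^{p+1}\Big)\,b^{-(p+1)}\,\mathbf e_{p+1}^\top\mathbf M_{p+1,b}^{-1}K(X_i/b)r_{p+1}(X_i/b),$$ i.e. the estimated leading bias, using the order-$(p+1)$ local polynomial estimate of $m^{(p+1)}(0)/(p+1)!$ with bandwidth $b$, is subtracted. They depend only on $X_1,\dots,X_n$ and satisfy $\sum_iw^{\mathrm{rbc}}_{i,h,b}(0)X_i^k=\delta_{k0}$ for $k=0,\dots,p+1$.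
   Formalization: For fixed n the matrices M can be singular with positive probability, leaving the weights undefined; such outcomes are counted as belonging to A_n and B_n (bandwidths g_n, l_n) and to C_n (either bandwidth pair), and as not covered by the interval. *)

theory Defs
  imports "HOL-Probability.Probability" "Jordan_Normal_Form.Gauss_Jordan_Elimination"
begin

section \<open>The regression model\<close>

text \<open>
  Observations are indexed by \<open>{1..n}\<close>; \<open>[lo, hi]\<close> is the interval in which the covariates live.
  The regression function and the variance function are only meaningful on \<open>[lo, hi]\<close>.
\<close>

definition sigma_of :: "'w measure \<Rightarrow> ('w \<Rightarrow> real) \<Rightarrow> 'w measure" where
  "sigma_of P Z = vimage_algebra (space P) Z borel"

definition regression_model ::
  "'w measure \<Rightarrow> nat \<Rightarrow> real \<Rightarrow> real \<Rightarrow> (real \<Rightarrow> real) \<Rightarrow> (real \<Rightarrow> real) \<Rightarrow>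
   (nat \<Rightarrow> 'w \<Rightarrow> real) \<Rightarrow> (nat \<Rightarrow> 'w \<Rightarrow> real) \<Rightarrow> (nat \<Rightarrow> 'w \<Rightarrow> real) \<Rightarrow> bool" where
  "regression_model P n lo hi m V X Y eps \<longleftrightarrow>
     prob_space P \<and>
     m \<in> borel_measurable (restrict_space borel {lo..hi}) \<and>
     V \<in> borel_measurable (restrict_space borel {lo..hi}) \<and>
     (\<forall>x\<in>{lo..hi}. 0 \<le> V x) \<and>
     (\<forall>i\<in>{1..n}.
        X i \<in> borel_measurable P \<and> Y i \<in> borel_measurable P \<and> eps i \<in> borel_measurable P \<and>
        (\<forall>\<omega>\<in>space P. Y i \<omega> = m (X i \<omega>) + sqrt (V (X i \<omega>)) * eps i \<omega>) \<and>
        integrable P (eps i) \<and> integrable P (\<lambda>\<omega>. (eps i \<omega>)\<^sup>2) \<and>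
        (AE \<omega> in P. real_cond_exp P (sigma_of P (X i)) (eps i) \<omega> = 0) \<and>
        (AE \<omega> in P. real_cond_exp P (sigma_of P (X i)) (\<lambda>\<omega>. (eps i \<omega>)\<^sup>2) \<omega> = 1))"

definition design_assumption ::
  "'w measure \<Rightarrow> nat \<Rightarrow> real \<Rightarrow> real \<Rightarrow> (real \<Rightarrow> real) \<Rightarrow>
   (nat \<Rightarrow> 'w \<Rightarrow> real) \<Rightarrow> (nat \<Rightarrow> 'w \<Rightarrow> real) \<Rightarrow> bool" where
  "design_assumption P n lo hi fX X Y \<longleftrightarrow>
     (lo = -1 \<and> hi = 1 \<or> lo = 0 \<and> hi = 1) \<and>
     prob_space.indep_vars P (\<lambda>_. borel :: (real \<times> real) measure)
       (\<lambda>i \<omega>. (X i \<omega>, Y i \<omega>)) {1..n} \<and>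
     (\<forall>i\<in>{1..n}. \<forall>\<omega>\<in>space P. X i \<omega> \<in> {lo..hi}) \<and>
     (\<forall>i\<in>{1..n}. distributed P lborel (X i) (\<lambda>x. ennreal (fX x) * indicator {lo..hi} x)) \<and>
     (\<exists>L. L-lipschitz_on {lo..hi} fX) \<and>
     (INF x\<in>{lo..hi}. fX x) > 0"

text \<open>
  Derivatives relative to a set \<open>T\<close>: two-sided at interior points, one-sided at endpoints
  of an interval.
\<close>

definition deriv_within :: "real set \<Rightarrow> nat \<Rightarrow> (real \<Rightarrow> real) \<Rightarrow> real \<Rightarrow> real" where
  "deriv_within T s f = ((\<lambda>g x. vector_derivative g (at x within T)) ^^ s) f"

definition times_differentiable_at :: "real set \<Rightarrow> nat \<Rightarrow> (real \<Rightarrow> real) \<Rightarrow> real \<Rightarrow> bool" where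
  "times_differentiable_at T S f x \<longleftrightarrow>
     (\<exists>\<delta>>0. \<forall>s. Suc s < S \<longrightarrow>
        (\<forall>y\<in>T \<inter> ball x \<delta>. deriv_within T s f differentiable (at y within T))) \<and>
     (\<forall>s<S. deriv_within T s f differentiable (at x within T))"

definition psi :: "nat \<Rightarrow> nat \<Rightarrow> real" where
  "psi S n = real n powr (- 1 / (2 * real S + 1)) * ln (real n)"

definition smoothness_assumption ::
  "nat \<Rightarrow> real \<Rightarrow> real \<Rightarrow> nat \<Rightarrow> real \<Rightarrow> (real \<Rightarrow> real) \<Rightarrow> (real \<Rightarrow> real) \<Rightarrow> (real \<Rightarrow> real) \<Rightarrow> bool" where
  "smoothness_assumption n lo hi S CS rS m V \<longleftrightarrow>
     times_differentiable_at {lo..hi} S m 0 \<and>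
     (\<forall>e\<in>{lo..hi}. \<bar>e\<bar> \<le> psi S n \<longrightarrow>
        \<bar>m e - m 0 - (\<Sum>s=1..S. deriv_within {lo..hi} s m 0 / fact s * e ^ s)\<bar>
          \<le> CS * rS \<bar>e\<bar> * \<bar>e\<bar> ^ S) \<and>
     CS > 0 \<and> (\<forall>t\<ge>0. rS t \<ge> 0) \<and> mono_on {0..} rS \<and> (rS \<longlongrightarrow> 0) (at_right 0) \<and>
     (\<exists>\<delta>>0. \<exists>L. L-lipschitz_on ({lo..hi} \<inter> ball 0 \<delta>) m) \<and>
     (\<exists>L. L-lipschitz_on {lo..hi} V) \<and> V 0 > 0"

definition moment_assumption ::
  "'w measure \<Rightarrow> nat \<Rightarrow> nat \<Rightarrow> real \<Rightarrow> real \<Rightarrow> (nat \<Rightarrow> 'w \<Rightarrow> real) \<Rightarrow> (nat \<Rightarrow> 'w \<Rightarrow> real) \<Rightarrow> bool" where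
  "moment_assumption P n S vs E X eps \<longleftrightarrow>
     vs > 4 + 1 / real S \<and>
     (\<forall>i\<in>{1..n}. AE \<omega> in P.
        nn_cond_exp P (sigma_of P (X i)) (\<lambda>\<omega>. ennreal (\<bar>eps i \<omega>\<bar> powr vs)) \<omega> \<le> ennreal E)"

section \<open>The robust bias corrected local polynomial estimator at 0\<close>

definition kernel_assumption :: "(real \<Rightarrow> real) \<Rightarrow> bool" where
  "kernel_assumption K \<longleftrightarrow>
     (\<forall>u. \<bar>K u\<bar> \<le> 1) \<and> (\<exists>L. L-lipschitz_on UNIV K) \<and> (\<forall>u. \<bar>u\<bar> > 1 \<longrightarrow> K u = 0)"

text \<open>In this section \<open>x 1, \<dots>, x n\<close> are the realised covariates.\<close>

definition rvec :: "nat \<Rightarrow> real \<Rightarrow> real vec" where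
  "rvec q u = vec (q + 1) (\<lambda>k. u ^ k)"

definition gram :: "(real \<Rightarrow> real) \<Rightarrow> nat \<Rightarrow> nat \<Rightarrow> real \<Rightarrow> (nat \<Rightarrow> real) \<Rightarrow> real mat" where
  "gram K q n h x = mat (q + 1) (q + 1) (\<lambda>(k, l).
     \<Sum>j=1..n. K (x j / h) * (vec_index (rvec q (x j / h)) k * vec_index (rvec q (x j / h)) l))"

text \<open>
  \<open>poly_coeff_weight K q n h x k i\<close> is the \<open>k\<close>-th entry of the inverse of \<open>gram K q n h x\<close>
  applied to \<open>K (x i / h) \<cdot> rvec q (x i / h)\<close>. It is unspecified when the Gram matrix is singular;
  see \<open>rbc_exists\<close>.
\<close>

definition poly_coeff_weight ::
  "(real \<Rightarrow> real) \<Rightarrow> nat \<Rightarrow> nat \<Rightarrow> real \<Rightarrow> (nat \<Rightarrow> real) \<Rightarrow> nat \<Rightarrow> nat \<Rightarrow> real" where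
  "poly_coeff_weight K q n h x k i =
     scalar_prod (unit_vec (q + 1) k)
       (the (mat_inverse (gram K q n h x)) *\<^sub>v (K (x i / h) \<cdot>\<^sub>v rvec q (x i / h)))"

definition rbc_weight ::
  "(real \<Rightarrow> real) \<Rightarrow> nat \<Rightarrow> nat \<Rightarrow> real \<Rightarrow> real \<Rightarrow> (nat \<Rightarrow> real) \<Rightarrow> nat \<Rightarrow> real" where
  "rbc_weight K p n h b x i =
     poly_coeff_weight K p n h x 0 i
     - (\<Sum>j=1..n. poly_coeff_weight K p n h x 0 j * x j ^ (p + 1))
       * (1 / b ^ (p + 1)) * poly_coeff_weight K (p + 1) n b x (p + 1) i"

text \<open>
  For fixed \<open>n\<close> the Gram matrices are singular with positive probability (for instance when no
  covariate falls into the kernel window), and then the weights do not exist. The events below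
  make this explicit: a bound on a quotient of weight functionals counts as exceeded when the
  weights do not exist, and an interval covers only when the weights that define it exist.
  When they exist the weights sum to 1, so no denominator below vanishes.
\<close>

definition rbc_exists ::
  "(real \<Rightarrow> real) \<Rightarrow> nat \<Rightarrow> nat \<Rightarrow> real \<Rightarrow> real \<Rightarrow> (nat \<Rightarrow> real) \<Rightarrow> bool" where
  "rbc_exists K p n h b x \<longleftrightarrow>
     invertible_mat (gram K p n h x) \<and> invertible_mat (gram K (p + 1) n b x)"

definition rbc_sumsq ::
  "(real \<Rightarrow> real) \<Rightarrow> nat \<Rightarrow> nat \<Rightarrow> real \<Rightarrow> real \<Rightarrow> (nat \<Rightarrow> real) \<Rightarrow> real" where
  "rbc_sumsq K p n h b x = (\<Sum>i=1..n. (rbc_weight K p n h b x i)\<^sup>2)"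

definition rbc_maxabs ::
  "(real \<Rightarrow> real) \<Rightarrow> nat \<Rightarrow> nat \<Rightarrow> real \<Rightarrow> real \<Rightarrow> (nat \<Rightarrow> real) \<Rightarrow> real" where
  "rbc_maxabs K p n h b x = Max ((\<lambda>i. \<bar>rbc_weight K p n h b x i\<bar>) ` {1..n})"

definition rbc_estimator ::
  "(real \<Rightarrow> real) \<Rightarrow> nat \<Rightarrow> nat \<Rightarrow> real \<Rightarrow> real \<Rightarrow> (nat \<Rightarrow> real) \<Rightarrow> (nat \<Rightarrow> real) \<Rightarrow> real" where
  "rbc_estimator K p n h b x y = (\<Sum>i=1..n. rbc_weight K p n h b x i * y i)"

definition rbc_bias ::
  "(real \<Rightarrow> real) \<Rightarrow> nat \<Rightarrow> nat \<Rightarrow> real \<Rightarrow> real \<Rightarrow> (real \<Rightarrow> real) \<Rightarrow> (nat \<Rightarrow> real) \<Rightarrow> real" where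
  "rbc_bias K p n h b m x = (\<Sum>i=1..n. rbc_weight K p n h b x i * (m (x i) - m 0))"

definition rbc_radius ::
  "(real \<Rightarrow> real) \<Rightarrow> nat \<Rightarrow> nat \<Rightarrow> real \<Rightarrow> real \<Rightarrow> real \<Rightarrow> real \<Rightarrow> (nat \<Rightarrow> real) \<Rightarrow> real" where
  "rbc_radius K p n \<sigma> \<alpha> h b x = \<sigma> * sqrt (2 * ln (1 / \<alpha>) * rbc_sumsq K p n h b x)"

end

theory Submission
  imports Defs "Jordan_Normal_Form.Determinant"
begin

text \<open>
  Write \<open>w i\<close> for the weights with bandwidths \<open>g\<close>, \<open>l\<close>, \<open>s\<close> for their sum of squares and
  \<open>L = ln (2 / \<alpha>)\<close>. Because the weights sum to \<open>1\<close>, the error of the estimator is the bias plus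
  \<open>\<sigma> * (\<Sum>i=1..n. w i * eps i)\<close>. Outside \<open>\<B>\<close> the bias is at most \<open>\<sigma> / 2 * sqrt (L * s)\<close>, and outside \<open>\<C>\<close>
  the radius is at least \<open>sqrt 8 * \<sigma> * sqrt (L * s)\<close>. The interval can thus fail to cover only if the
  weighted noise exceeds \<open>(sqrt 8 - 1 / 2) * sqrt (L * s)\<close> (\<open>rbc_interval_covers\<close>). This is more than
  \<open>3 / sqrt 2 * sqrt (L * s)\<close>, a threshold that is exceeded outside \<open>\<A>\<close> with probability at most
  \<open>2 * exp (- L) = \<alpha>\<close> by a Bernstein bound (\<open>self_normalized_tail\<close>). A union bound gives the theorem.

  The weights are random and each depends on all covariates, so the Bernstein bound has to hold
  given the covariates. Conditional distributions are avoided: \<open>expectation_exp_noise_le_1\<close> bounds the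
  compensated exponential moment for any coefficients that are measurable functions of the
  covariates, by removing one noise term at a time. Each removal rests on
  \<open>expectation_mult_noise\<close>, which combines independence across observations (through Fubini's theorem)
  with the conditional moments of one noise term given its own covariate. Measurability of the
  weights and of all events is proved as well, since the measure of a set that is not measurable
  is \<open>0\<close> by convention and would say nothing.
\<close>

section \<open>Existence, normalisation and measurability of the weights\<close>

lemma invertible_mat_iff_det:
  fixes A :: "real mat"
  assumes A: "A \<in> carrier_mat N N"
  shows "invertible_mat A \<longleftrightarrow> Determinant.det A \<noteq> 0"
proof
  assume "invertible_mat A"
  then obtain C where C: "A * C = 1\<^sub>m N" "C * A = 1\<^sub>m (dim_row C)"
    using A by (auto simp: invertible_mat_def inverts_mat_def)
  have "dim_row C = N" "dim_col C = N"
    using arg_cong[OF C(1), of dim_col] arg_cong[OF C(2), of dim_col] A by auto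
  then have "C \<in> carrier_mat N N" by auto
  from det_mult[OF A this] show "Determinant.det A \<noteq> 0"
    unfolding C(1) by auto
next
  assume d: "Determinant.det A \<noteq> 0"
  let ?C = "inverse (Determinant.det A) \<cdot>\<^sub>m adj_mat A"
  note adj = adj_mat[OF A]
  have "A * ?C = inverse (Determinant.det A) \<cdot>\<^sub>m (A * adj_mat A)" "?C * A = inverse (Determinant.det A) \<cdot>\<^sub>m (adj_mat A * A)"
    using mult_smult_distrib[OF A adj(1)] mult_smult_assoc_mat[OF adj(1) A] by auto
  then have "A * ?C = 1\<^sub>m N" "?C * A = 1\<^sub>m N"
    unfolding adj(2,3) using d by (auto intro!: eq_matI)
  then show "invertible_mat A"
    using A adj(1) unfolding invertible_mat_def inverts_mat_def
    by (intro conjI exI[of _ ?C]) auto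
qed

text \<open>
  The inverse is written through the adjugate because the entries of the adjugate and the
  determinant are polynomials in the entries of the matrix. This makes measurability of the
  weights visible, which the elimination algorithm behind \<open>mat_inverse\<close> does not.
\<close>

lemma mat_inverse_eq:
  fixes A :: "real mat"
  assumes A: "A \<in> carrier_mat N N"
  shows "mat_inverse A = (if Determinant.det A = 0 then None else Some (inverse (Determinant.det A) \<cdot>\<^sub>m adj_mat A))"
proof (cases "mat_inverse A")
  case None
  have "A \<notin> Units (ring_mat TYPE(real) N ())"
    by (rule mat_inverse(1)[OF A None])
  moreover have "A \<in> Units (ring_mat TYPE(real) N ())" if "Determinant.det A \<noteq> 0"
    using that by (rule det_non_zero_imp_unit[OF A])
  ultimately have "Determinant.det A = 0" by blast
  then show ?thesis using None by simp
next
  case (Some C)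
  from mat_inverse(2)[OF A Some]
  have C: "A * C = 1\<^sub>m N" "C * A = 1\<^sub>m N" "C \<in> carrier_mat N N" by auto
  have d: "Determinant.det A \<noteq> 0"
    using det_mult[OF A C(3)] unfolding C(1) by auto
  note adj = adj_mat[OF A]
  have "C * (A * adj_mat A) = adj_mat A"
    using assoc_mult_mat[OF C(3) A adj(1)] C(2) adj(1) by simp
  moreover have "C * (A * adj_mat A) = Determinant.det A \<cdot>\<^sub>m C"
    unfolding adj(2) using C(3) mult_smult_distrib[OF C(3) one_carrier_mat] by simp
  ultimately have "adj_mat A = Determinant.det A \<cdot>\<^sub>m C" by simp
  then have "inverse (Determinant.det A) \<cdot>\<^sub>m adj_mat A = C"
    using d by (auto intro!: eq_matI)
  with d Some show ?thesis by simp
qed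

lemma gram_carrier: "gram K q n h x \<in> carrier_mat (q + 1) (q + 1)"
  by (simp add: gram_def)

lemma rbc_exists_iff_det:
  "rbc_exists K p n h b x \<longleftrightarrow> Determinant.det (gram K p n h x) \<noteq> 0 \<and> Determinant.det (gram K (p + 1) n b x) \<noteq> 0"
  unfolding rbc_exists_def by (simp only: invertible_mat_iff_det[OF gram_carrier])

lemma poly_coeff_weight_eq_sum:
  assumes C: "mat_inverse (gram K q n h x) = Some C" and k: "k \<le> q"
  shows "poly_coeff_weight K q n h x k i
    = (\<Sum>j<q + 1. C $$ (k, j) * (K (x i / h) * (x i / h) ^ j))"
proof -
  have Cc: "C \<in> carrier_mat (q + 1) (q + 1)"
    using mat_inverse(2)[OF gram_carrier C] by auto
  let ?v = "K (x i / h) \<cdot>\<^sub>v rvec q (x i / h)"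
  have "poly_coeff_weight K q n h x k i = (C *\<^sub>v ?v) $ k"
    unfolding poly_coeff_weight_def C option.sel
    using Cc k by (intro scalar_prod_left_unit mult_mat_vec_carrier[OF Cc]) (auto simp: rvec_def)
  also have "\<dots> = Matrix.row C k \<bullet> ?v"
    using Cc k by simp
  also have "\<dots> = (\<Sum>j<q + 1. C $$ (k, j) * (K (x i / h) * (x i / h) ^ j))"
    unfolding scalar_prod_def lessThan_atLeast0
    using Cc k by (intro sum.cong) (auto simp: rvec_def)
  finally show ?thesis .
qed

text \<open>
  The vectors \<open>K (x i / h) \<cdot>\<^sub>v rvec q (x i / h)\<close> add up to column \<open>0\<close> of the Gram matrix, because
  entry \<open>0\<close> of \<open>rvec\<close> is \<open>1\<close>; the inverse maps that column to the unit vector \<open>0\<close>.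
\<close>

lemma sum_poly_coeff_weight:
  assumes "Determinant.det (gram K q n h x) \<noteq> 0" and k: "k \<le> q"
  shows "(\<Sum>i=1..n. poly_coeff_weight K q n h x k i) = (if k = 0 then 1 else 0)"
proof -
  let ?A = "gram K q n h x"
  obtain C where C: "mat_inverse ?A = Some C"
    using assms(1) mat_inverse_eq[OF gram_carrier] by auto
  from mat_inverse(2)[OF gram_carrier C]
  have CA: "C * ?A = 1\<^sub>m (q + 1)" and Cc: "C \<in> carrier_mat (q + 1) (q + 1)" by auto
  note w = poly_coeff_weight_eq_sum[OF C k]
  have "(\<Sum>i=1..n. poly_coeff_weight K q n h x k i)
      = (\<Sum>j<q + 1. C $$ (k, j) * (\<Sum>i=1..n. K (x i / h) * (x i / h) ^ j))"
    unfolding w by (subst sum.swap) (simp add: sum_distrib_left)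
  also have "\<dots> = (C * ?A) $$ (k, 0)"
    using Cc k
    by (simp add: gram_def rvec_def scalar_prod_def lessThan_atLeast0 del: sum.op_ivl_Suc sum.lessThan_Suc)
  finally show ?thesis unfolding CA using k by simp
qed

text \<open>
  The bias correction subtracts multiples of weights for coefficient \<open>p + 1\<close>, which sum to \<open>0\<close>.
  Reproducing constants turns the error of the estimator into bias plus noise, and it keeps the sum
  of squares away from \<open>0\<close>.
\<close>

lemma sum_rbc_weight:
  assumes "rbc_exists K p n h b x"
  shows "(\<Sum>i=1..n. rbc_weight K p n h b x i) = 1"
proof -
  let ?u = "\<lambda>i. poly_coeff_weight K p n h x 0 i"
    and ?v = "\<lambda>i. poly_coeff_weight K (p + 1) n b x (p + 1) i"
  have u: "(\<Sum>i=1..n. ?u i) = 1" and v: "(\<Sum>i=1..n. ?v i) = 0"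
    using assms sum_poly_coeff_weight[of K p n h x 0] sum_poly_coeff_weight[of K "p + 1" n b x "p + 1"]
    by (auto simp: rbc_exists_iff_det)
  have "(\<Sum>i=1..n. rbc_weight K p n h b x i)
      = (\<Sum>i=1..n. ?u i) - (\<Sum>j=1..n. ?u j * x j ^ (p + 1)) * (1 / b ^ (p + 1)) * (\<Sum>i=1..n. ?v i)"
    unfolding rbc_weight_def sum_subtractf sum_distrib_left ..
  then show ?thesis unfolding u v by simp
qed

lemma rbc_sumsq_pos:
  assumes "rbc_exists K p n h b x"
  shows "0 < rbc_sumsq K p n h b x"
proof -
  have "\<exists>i\<in>{1..n}. rbc_weight K p n h b x i \<noteq> 0"
    using sum_rbc_weight[OF assms] sum.neutral by force
  then show ?thesis
    unfolding rbc_sumsq_def by (auto intro!: sum_pos2 simp del: atLeastAtMost_iff)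
qed

lemma borel_measurable_det:
  fixes A :: "'a \<Rightarrow> real mat"
  assumes "\<And>\<omega>. A \<omega> \<in> carrier_mat N N"
    and "\<And>i j. i < N \<Longrightarrow> j < N \<Longrightarrow> (\<lambda>\<omega>. A \<omega> $$ (i, j)) \<in> borel_measurable M"
  shows "(\<lambda>\<omega>. Determinant.det (A \<omega>)) \<in> borel_measurable M"
proof -
  have "Determinant.det (A \<omega>) = (\<Sum>\<pi> | \<pi> permutes {0..<N}. signof \<pi> * (\<Prod>i=0..<N. A \<omega> $$ (i, \<pi> i)))" for \<omega>
    using assms(1)[of \<omega>] by (rule Determinant.det_def')
  then show ?thesis
    using assms(2) permutes_in_image
    by (auto intro!: borel_measurable_sum borel_measurable_times borel_measurable_prod)
qed

lemma borel_measurable_adj_mat: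
  fixes A :: "'a \<Rightarrow> real mat"
  assumes A: "\<And>\<omega>. A \<omega> \<in> carrier_mat N N"
    and m: "\<And>i j. i < N \<Longrightarrow> j < N \<Longrightarrow> (\<lambda>\<omega>. A \<omega> $$ (i, j)) \<in> borel_measurable M"
    and ij: "i < N" "j < N"
  shows "(\<lambda>\<omega>. adj_mat (A \<omega>) $$ (i, j)) \<in> borel_measurable M"
proof -
  have dims: "dim_row (A \<omega>) = N" "dim_col (A \<omega>) = N" for \<omega>
    using A[of \<omega>] by auto
  have "(\<lambda>\<omega>. Determinant.det (mat_delete (A \<omega>) j i)) \<in> borel_measurable M"
    by (rule borel_measurable_det[where N = "N - 1"])
      (auto simp: mat_delete_def dims intro!: m)
  then show ?thesis
    using ij by (simp add: adj_mat_def dims cofactor_def)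
qed

text \<open>
  Measurability of the weights is shown for an arbitrary measurable family of designs, because it
  is used twice: for the random covariates on the probability space, and for the coordinates on
  the product space \<open>\<real>\<^sup>n\<close>, where the weights act as functions of the covariates alone.
\<close>

context
  fixes M :: "'a measure" and x :: "'a \<Rightarrow> nat \<Rightarrow> real" and n :: nat and K :: "real \<Rightarrow> real"
  assumes K [measurable]: "K \<in> borel_measurable borel"
    and x: "\<And>j. j \<in> {1..n} \<Longrightarrow> (\<lambda>\<omega>. x \<omega> j) \<in> borel_measurable M"
begin

lemma borel_measurable_gram_entry:
  assumes "k \<le> q" "l \<le> q"
  shows "(\<lambda>\<omega>. gram K q n h (x \<omega>) $$ (k, l)) \<in> borel_measurable M"
proof -
  have [measurable]: "(\<lambda>\<omega>. K (x \<omega> j / h)) \<in> borel_measurable M" if "j \<in> {1..n}" for j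
    using measurable_compose[OF borel_measurable_divide[OF x[OF that] measurable_const] K] by simp
  have "(\<lambda>\<omega>. \<Sum>j=1..n. K (x \<omega> j / h) * ((x \<omega> j / h) ^ k * (x \<omega> j / h) ^ l)) \<in> borel_measurable M"
    using x by (intro borel_measurable_sum borel_measurable_times borel_measurable_power
        borel_measurable_divide) auto
  then show ?thesis using assms by (simp add: gram_def rvec_def)
qed

lemma borel_measurable_det_gram: "(\<lambda>\<omega>. Determinant.det (gram K q n h (x \<omega>))) \<in> borel_measurable M"
  by (rule borel_measurable_det[OF gram_carrier]) (auto intro: borel_measurable_gram_entry)

lemma borel_measurable_poly_coeff_weight:
  assumes i: "i \<in> {1..n}" and k: "k \<le> q"
  shows "(\<lambda>\<omega>. poly_coeff_weight K q n h (x \<omega>) k i) \<in> borel_measurable M"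
proof -
  let ?A = "\<lambda>\<omega>. gram K q n h (x \<omega>)"
  have Kx: "(\<lambda>\<omega>. K (x \<omega> i / h)) \<in> borel_measurable M"
    using measurable_compose[OF borel_measurable_divide[OF x[OF i] measurable_const] K] by simp
  have r: "(\<lambda>\<omega>. (K (x \<omega> i / h) \<cdot>\<^sub>v rvec q (x \<omega> i / h)) $ c) \<in> borel_measurable M" if "c < q + 1" for c
    using that x[OF i] Kx by (auto simp: rvec_def)
  \<comment> \<open>On singular designs the inverse is a fixed unknown matrix, and nothing may be assumed about
    its dimensions.\<close>
  have sing: "(\<lambda>\<omega>. unit_vec (q + 1) k \<bullet> (D *\<^sub>v (K (x \<omega> i / h) \<cdot>\<^sub>v rvec q (x \<omega> i / h))))
      \<in> borel_measurable M" (is "?f \<in> _") for D :: "real mat"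
  proof -
    have "?f = (\<lambda>\<omega>. \<Sum>a<dim_row D. unit_vec (q + 1) k $ a *
        (\<Sum>c<q + 1. Matrix.row D a $ c * (K (x \<omega> i / h) \<cdot>\<^sub>v rvec q (x \<omega> i / h)) $ c))"
      by (auto simp: scalar_prod_def mult_mat_vec_def rvec_def lessThan_atLeast0 fun_eq_iff
          intro!: sum.cong)
    then show ?thesis
      using r by (auto intro!: borel_measurable_sum borel_measurable_times)
  qed
  have adj: "(\<lambda>\<omega>. adj_mat (?A \<omega>) $$ (a, c)) \<in> borel_measurable M" if "a < q + 1" "c < q + 1" for a c
    by (rule borel_measurable_adj_mat[OF gram_carrier _ that])
      (auto intro: borel_measurable_gram_entry)
  have reg: "poly_coeff_weight K q n h (x \<omega>) k i = (\<Sum>c<q + 1.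
      inverse (Determinant.det (?A \<omega>)) * adj_mat (?A \<omega>) $$ (k, c) * (K (x \<omega> i / h) \<cdot>\<^sub>v rvec q (x \<omega> i / h)) $ c)"
    if "Determinant.det (?A \<omega>) \<noteq> 0" for \<omega>
    using that k adj_mat(1)[OF gram_carrier, of K q n h "x \<omega>"]
      poly_coeff_weight_eq_sum[of K q n h "x \<omega>" "inverse (Determinant.det (?A \<omega>)) \<cdot>\<^sub>m adj_mat (?A \<omega>)" k i]
    by (simp add: mat_inverse_eq[OF gram_carrier] rvec_def)
  have eq: "poly_coeff_weight K q n h (x \<omega>) k i = (if Determinant.det (?A \<omega>) = 0
      then unit_vec (q + 1) k \<bullet> (the (None :: real mat option) *\<^sub>v (K (x \<omega> i / h) \<cdot>\<^sub>v rvec q (x \<omega> i / h)))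
      else (\<Sum>c<q + 1. inverse (Determinant.det (?A \<omega>)) * adj_mat (?A \<omega>) $$ (k, c)
        * (K (x \<omega> i / h) \<cdot>\<^sub>v rvec q (x \<omega> i / h)) $ c))" for \<omega>
    using reg[of \<omega>] by (auto simp: poly_coeff_weight_def mat_inverse_eq[OF gram_carrier])
  have p: "Measurable.pred M (\<lambda>\<omega>. Determinant.det (?A \<omega>) = 0)"
    using borel_measurable_det_gram[of q h] by measurable
  show ?thesis
    unfolding eq using k
    by (intro measurable_If sing predE[OF p] borel_measurable_sum borel_measurable_times adj r
        borel_measurable_inverse borel_measurable_det_gram) auto
qed

lemma pred_rbc_exists: "Measurable.pred M (\<lambda>\<omega>. rbc_exists K p n h b (x \<omega>))"
  unfolding rbc_exists_iff_det
  using borel_measurable_det_gram[of p h] borel_measurable_det_gram[of "p + 1" b] by measurable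

lemma borel_measurable_rbc_weight:
  assumes "i \<in> {1..n}"
  shows "(\<lambda>\<omega>. rbc_weight K p n h b (x \<omega>) i) \<in> borel_measurable M"
  unfolding rbc_weight_def using assms x
  by (intro borel_measurable_diff borel_measurable_times borel_measurable_sum
      borel_measurable_power borel_measurable_poly_coeff_weight measurable_const) auto

lemma borel_measurable_rbc_sumsq:
  "(\<lambda>\<omega>. rbc_sumsq K p n h b (x \<omega>)) \<in> borel_measurable M"
  unfolding rbc_sumsq_def
  by (intro borel_measurable_sum borel_measurable_power borel_measurable_rbc_weight)

lemma borel_measurable_rbc_maxabs:
  "(\<lambda>\<omega>. rbc_maxabs K p n h b (x \<omega>)) \<in> borel_measurable M"
  unfolding rbc_maxabs_def
  by (intro borel_measurable_Max borel_measurable_abs borel_measurable_rbc_weight) auto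

lemma borel_measurable_rbc_estimator:
  assumes "\<And>j. j \<in> {1..n} \<Longrightarrow> (\<lambda>\<omega>. y \<omega> j) \<in> borel_measurable M"
  shows "(\<lambda>\<omega>. rbc_estimator K p n h b (x \<omega>) (y \<omega>)) \<in> borel_measurable M"
  unfolding rbc_estimator_def using assms
  by (intro borel_measurable_sum borel_measurable_times borel_measurable_rbc_weight) auto

lemma borel_measurable_rbc_radius:
  "(\<lambda>\<omega>. rbc_radius K p n \<sigma> \<alpha> h b (x \<omega>)) \<in> borel_measurable M"
  unfolding rbc_radius_def using borel_measurable_rbc_sumsq[of p h b] by measurable

end

lemma gram_cong: "(\<And>j. j \<in> {1..n} \<Longrightarrow> x j = x' j) \<Longrightarrow> gram K q n h x = gram K q n h x'"
  unfolding gram_def by (auto intro!: cong_mat sum.cong)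

lemma rbc_exists_cong:
  "(\<And>j. j \<in> {1..n} \<Longrightarrow> x j = x' j) \<Longrightarrow> rbc_exists K p n h b x = rbc_exists K p n h b x'"
  unfolding rbc_exists_def by (simp only: gram_cong[of n x x'])

lemma rbc_weight_cong:
  assumes "\<And>j. j \<in> {1..n} \<Longrightarrow> x j = x' j" and "i \<in> {1..n}"
  shows "rbc_weight K p n h b x i = rbc_weight K p n h b x' i"
proof -
  have "gram K q n c x = gram K q n c x'" for q c
    using assms(1) by (rule gram_cong)
  then have "poly_coeff_weight K q n c x k j = poly_coeff_weight K q n c x' k j"
    if "j \<in> {1..n}" for q c k j
    unfolding poly_coeff_weight_def using assms(1) that by simp
  then show ?thesis
    unfolding rbc_weight_def using assms by simp
qed

section \<open>Conditional moments of the noise\<close>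

text \<open>
  Since \<open>2 \<cdot> 3 ^ k \<le> fact (k + 2)\<close>, the tail of the exponential series from degree \<open>2\<close> on is
  dominated by \<open>y\<^sup>2 / 2\<close> times a geometric series with ratio \<open>\<bar>y\<bar> / 3 \<le> 1 / 2\<close>. This is the inequality
  behind Bernstein's bound, at the point where the constant in front of \<open>y\<^sup>2\<close> becomes \<open>1\<close>.
\<close>

lemma exp_le_quadratic:
  fixes y :: real
  assumes "\<bar>y\<bar> \<le> 3 / 2"
  shows "exp y \<le> 1 + y + y\<^sup>2"
proof -
  have fact_ge: "2 * 3 ^ k \<le> (fact (k + 2) :: real)" for k
  proof (induction k)
    case (Suc k)
    have "2 * 3 ^ Suc k \<le> real (k + 3) * fact (k + 2)"
      using mult_mono[of 3 "real (k + 3)" "2 * 3 ^ k" "fact (k + 2)"] Suc by simp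
    then show ?case by (simp add: algebra_simps)
  qed simp
  let ?t = "\<lambda>k. y ^ k /\<^sub>R fact k"
  have t: "?t sums exp y" by (rule exp_converges)
  have tail: "(\<lambda>k. ?t (k + 2)) sums (exp y - (1 + y))"
    using sums_split_initial_segment[OF t, of 2] by (simp add: eval_nat_numeral)
  have geo: "(\<lambda>k. y\<^sup>2 / 2 * (1 / 2) ^ k) sums (y\<^sup>2 / 2 * 2)"
    using geometric_sums[of "1 / 2 :: real"] by (intro sums_mult) simp
  have "?t (k + 2) \<le> y\<^sup>2 / 2 * (1 / 2) ^ k" for k
  proof -
    have "?t (k + 2) \<le> \<bar>y\<bar> ^ (k + 2) / fact (k + 2)"
      using abs_ge_self[of "y ^ (k + 2)"]
      by (simp add: divide_inverse mult.commute power_abs[symmetric] mult_left_mono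
          del: power_Suc add_2_eq_Suc')
    also have "\<dots> \<le> \<bar>y\<bar> ^ (k + 2) / (2 * 3 ^ k)"
      using fact_ge[of k] by (intro divide_left_mono) auto
    also have "\<dots> = y\<^sup>2 / 2 * (\<bar>y\<bar> / 3) ^ k"
      by (simp add: power_add power_divide power2_eq_square)
    also have "\<dots> \<le> y\<^sup>2 / 2 * (1 / 2) ^ k"
      using assms by (intro mult_left_mono power_mono) auto
    finally show ?thesis .
  qed
  from sums_le[OF this tail geo] show ?thesis by simp
qed

lemma (in prob_space) sigma_of_subalgebra:
  assumes "X \<in> borel_measurable M"
  shows "finite_measure_subalgebra M (sigma_of M X)"
proof
  show "subalgebra M (sigma_of M X)"
    using assms unfolding subalgebra_def sigma_of_def sets_vimage_algebra
    by (auto intro!: sets.sigma_sets_subset measurable_sets)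
qed

text \<open>
  A substitute for conditioning on all covariates and on all noise terms except \<open>e i\<close>. The
  hypothesis fixes the conditional mean of \<open>\<phi> (e i)\<close> given \<open>X i\<close> only; independence of the pairs says
  that the other pairs carry no further information about \<open>e i\<close>. By Fubini's theorem the other
  pairs may be frozen, which turns \<open>H\<close> into a function of \<open>X i\<close>, and then the defining property of the
  conditional expectation applies.
\<close>

lemma (in prob_space) expectation_mult_noise:
  fixes X e :: "'i \<Rightarrow> 'a \<Rightarrow> real"
  assumes ind: "indep_vars (\<lambda>_. borel :: (real \<times> real) measure) (\<lambda>i \<omega>. (X i \<omega>, e i \<omega>)) I"
    and i: "i \<in> I"
    and ce: "AE \<omega> in M. real_cond_exp M (sigma_of M (X i)) (\<lambda>\<omega>. \<phi> (e i \<omega>)) \<omega> = k"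
    and \<phi> [measurable]: "\<phi> \<in> borel_measurable borel"
    and H [measurable]: "H \<in> borel_measurable (Pi\<^sub>M I (\<lambda>_. borel :: (real \<times> real) measure))"
    and ignores: "\<And>z y. H (z(i := (fst (z i), y))) = H z"
    and int1: "integrable M (\<lambda>\<omega>. H (\<lambda>j\<in>I. (X j \<omega>, e j \<omega>)))"
    and int2: "integrable M (\<lambda>\<omega>. H (\<lambda>j\<in>I. (X j \<omega>, e j \<omega>)) * \<phi> (e i \<omega>))"
  shows "expectation (\<lambda>\<omega>. H (\<lambda>j\<in>I. (X j \<omega>, e j \<omega>)) * \<phi> (e i \<omega>))
    = k * expectation (\<lambda>\<omega>. H (\<lambda>j\<in>I. (X j \<omega>, e j \<omega>)))"
proof -
  let ?B = "borel :: (real \<times> real) measure"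
  let ?P = "Pi\<^sub>M (I - {i}) (\<lambda>_. ?B)"
  define Z where "Z j \<omega> = (X j \<omega>, e j \<omega>)" for j \<omega>
  let ?Q = "Pi\<^sub>M {i} (\<lambda>_. ?B)"
  \<comment> \<open>The pair \<open>i\<close> is kept as a family indexed by \<open>{i}\<close> because \<open>indep_var\<close> wants both variables to
    have the same type.\<close>
  define U where "U \<omega> = (\<lambda>j\<in>{i}. Z j \<omega>)" for \<omega>
  define R where "R \<omega> = (\<lambda>j\<in>I - {i}. Z j \<omega>)" for \<omega>
  have indZ: "indep_vars (\<lambda>_. ?B) Z I"
    using ind unfolding Z_def .
  have Zi [measurable]: "Z i \<in> borel_measurable M"
    using indZ i by (auto simp: indep_vars_def)
  have Xe [measurable]: "X i \<in> borel_measurable M" "e i \<in> borel_measurable M"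
    using measurable_compose[OF Zi borel_measurable_continuous_onI[of fst]]
      measurable_compose[OF Zi borel_measurable_continuous_onI[of snd]]
    by (auto simp: Z_def continuous_on_fst continuous_on_snd)
  have "indep_var ?P R ?Q U"
    unfolding R_def U_def using i by (intro indep_var_restrict[OF indZ]) auto
  then have R [measurable]: "R \<in> measurable M ?P" and U [measurable]: "U \<in> measurable M ?Q"
    and joint: "distr M ?P R \<Otimes>\<^sub>M distr M ?Q U = distr M (?P \<Otimes>\<^sub>M ?Q) (\<lambda>\<omega>. (R \<omega>, U \<omega>))"
    unfolding indep_var_distribution_eq by auto
  let ?N = "distr M ?P R" and ?\<mu> = "distr M ?Q U"
  interpret N: prob_space ?N by (rule prob_space_distr) simp
  interpret \<mu>: prob_space ?\<mu> by (rule prob_space_distr) simp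
  interpret NM: pair_sigma_finite ?N ?\<mu> by unfold_locales
  interpret F: finite_measure_subalgebra M "sigma_of M (X i)"
    by (rule sigma_of_subalgebra) simp
  have upd [measurable]: "(\<lambda>(z, u). H (z(i := u))) \<in> borel_measurable (?P \<Otimes>\<^sub>M ?B)"
  proof -
    have "(\<lambda>(z, u). z(i := u)) \<in> measurable (?P \<Otimes>\<^sub>M ?B) (Pi\<^sub>M (insert i (I - {i})) (\<lambda>_. ?B))"
      by (rule measurable_add_dim)
    then have "(\<lambda>w. H ((\<lambda>(z, u). z(i := u)) w)) \<in> borel_measurable (?P \<Otimes>\<^sub>M ?B)"
      using i by (intro measurable_compose[OF _ H]) (simp add: insert_absorb)
    then show ?thesis by (simp add: case_prod_unfold)
  qed
  have snd_m [measurable]: "snd \<in> borel_measurable ?B"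
    by (simp add: borel_measurable_continuous_onI continuous_on_snd)
  have U_i: "U \<omega> i = (X i \<omega>, e i \<omega>)" for \<omega>
    by (simp add: U_def Z_def)
  have reassemble: "(R \<omega>)(i := (X i \<omega>, e i \<omega>)) = (\<lambda>j\<in>I. (X j \<omega>, e j \<omega>))" for \<omega>
    using i by (auto simp: R_def U_def Z_def fun_eq_iff)
  \<comment> \<open>In the inner integral \<open>H\<close> is evaluated with \<open>0\<close> in place of \<open>e i\<close>, an arbitrary value that \<open>H\<close>
    ignores: this makes the integrand visibly a function of \<open>X i\<close>.\<close>
  have fubini: "(\<integral>\<omega>. H (\<lambda>j\<in>I. (X j \<omega>, e j \<omega>)) * g (e i \<omega>) \<partial>M)
        = (\<integral>z. (\<integral>\<omega>. H (z(i := (X i \<omega>, 0))) * g (e i \<omega>) \<partial>M) \<partial>?N)" (is ?eq)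
    and fubini_AE: "AE z in ?N. integrable M (\<lambda>\<omega>. H (z(i := (X i \<omega>, 0))) * g (e i \<omega>))" (is ?ae)
    if int: "integrable M (\<lambda>\<omega>. H (\<lambda>j\<in>I. (X j \<omega>, e j \<omega>)) * g (e i \<omega>))"
      and g [measurable]: "g \<in> borel_measurable borel" for g :: "real \<Rightarrow> real"
  proof -
    let ?h = "\<lambda>(z, u). H (z(i := u i)) * g (snd (u i))"
    have h [measurable]: "?h \<in> borel_measurable (?P \<Otimes>\<^sub>M ?Q)"
    proof -
      have "(\<lambda>(z, u). (z, u i)) \<in> measurable (?P \<Otimes>\<^sub>M ?Q) (?P \<Otimes>\<^sub>M ?B)"
        by measurable
      from measurable_compose[OF this upd]
      have "(\<lambda>(z, u). H (z(i := u i))) \<in> borel_measurable (?P \<Otimes>\<^sub>M ?Q)"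
        by (simp add: case_prod_unfold)
      then show ?thesis by measurable
    qed
    have hs: "(\<lambda>u. H (z(i := u i)) * g (snd (u i))) \<in> borel_measurable ?Q" if "z \<in> space ?N" for z
      using measurable_compose[OF measurable_Pair1'[of z ?P ?Q] h] that by simp
    have Hz: "H (z(i := (X i \<omega>, 0))) = H (z(i := U \<omega> i))" for z \<omega>
      using ignores[of "z(i := U \<omega> i)" 0] by (simp add: U_i)
    have inth: "integrable (?N \<Otimes>\<^sub>M ?\<mu>) ?h"
      unfolding joint using int by (subst integrable_distr_eq) (simp_all add: reassemble U_i)
    have "(\<integral>\<omega>. H (\<lambda>j\<in>I. (X j \<omega>, e j \<omega>)) * g (e i \<omega>) \<partial>M) = integral\<^sup>L (?N \<Otimes>\<^sub>M ?\<mu>) ?h"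
      unfolding joint by (subst integral_distr) (simp_all add: reassemble U_i)
    also have "\<dots> = (\<integral>z. (\<integral>u. H (z(i := u i)) * g (snd (u i)) \<partial>?\<mu>) \<partial>?N)"
      using NM.integral_fst'[OF inth] by simp
    also have "\<dots> = (\<integral>z. (\<integral>\<omega>. H (z(i := (X i \<omega>, 0))) * g (e i \<omega>) \<partial>M) \<partial>?N)"
    proof (rule Bochner_Integration.integral_cong[OF refl])
      fix z assume z: "z \<in> space ?N"
      show "(\<integral>u. H (z(i := u i)) * g (snd (u i)) \<partial>?\<mu>) = (\<integral>\<omega>. H (z(i := (X i \<omega>, 0))) * g (e i \<omega>) \<partial>M)"
        unfolding Hz by (subst integral_distr[OF U hs[OF z]]) (simp add: U_i)
    qed
    finally show ?eq .
    have "AE z in ?N. integrable ?\<mu> (\<lambda>u. H (z(i := u i)) * g (snd (u i)))"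
      using NM.AE_integrable_fst'[OF inth] by simp
    then show ?ae
    proof (rule AE_mp, intro AE_I2 impI)
      fix z assume z: "z \<in> space ?N" and "integrable ?\<mu> (\<lambda>u. H (z(i := u i)) * g (snd (u i)))"
      then show "integrable M (\<lambda>\<omega>. H (z(i := (X i \<omega>, 0))) * g (e i \<omega>))"
        unfolding Hz using integrable_distr_eq[OF U hs[OF z]] by (simp add: U_i)
    qed
  qed
  have inner: "(\<integral>\<omega>. H (z(i := (X i \<omega>, 0))) * \<phi> (e i \<omega>) \<partial>M)
      = k * (\<integral>\<omega>. H (z(i := (X i \<omega>, 0))) \<partial>M)"
    if z: "z \<in> space ?N" and int: "integrable M (\<lambda>\<omega>. H (z(i := (X i \<omega>, 0))) * \<phi> (e i \<omega>))" for z
  proof -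
    have "(\<lambda>v. (z, (v, 0::real))) \<in> measurable borel (?P \<Otimes>\<^sub>M ?B)"
      using z by (intro measurable_Pair) auto
    from measurable_compose[OF this upd]
    have v: "(\<lambda>v. H (z(i := (v, 0)))) \<in> borel_measurable borel" by simp
    have "X i \<in> measurable (sigma_of M (X i)) borel"
      unfolding sigma_of_def by (rule measurable_vimage_algebra1) simp
    from measurable_compose[OF this v]
    have HX: "(\<lambda>\<omega>. H (z(i := (X i \<omega>, 0)))) \<in> borel_measurable (sigma_of M (X i))" .
    have "(\<integral>\<omega>. H (z(i := (X i \<omega>, 0))) * \<phi> (e i \<omega>) \<partial>M)
        = (\<integral>\<omega>. H (z(i := (X i \<omega>, 0))) * real_cond_exp M (sigma_of M (X i)) (\<lambda>\<omega>. \<phi> (e i \<omega>)) \<omega> \<partial>M)"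
      by (rule F.real_cond_exp_intg(2)[OF int HX, symmetric]) simp
    also have "\<dots> = (\<integral>\<omega>. H (z(i := (X i \<omega>, 0))) * k \<partial>M)"
      using ce measurable_from_subalg[OF F.subalg HX] measurable_from_subalg[OF F.subalg borel_measurable_cond_exp]
      by (intro integral_cong_AE) auto
    finally show ?thesis by simp
  qed
  have "expectation (\<lambda>\<omega>. H (\<lambda>j\<in>I. (X j \<omega>, e j \<omega>)) * \<phi> (e i \<omega>))
      = (\<integral>z. (\<integral>\<omega>. H (z(i := (X i \<omega>, 0))) * \<phi> (e i \<omega>) \<partial>M) \<partial>?N)"
    using fubini[OF int2 \<phi>] .
  also have "\<dots> = (\<integral>z. k * (\<integral>\<omega>. H (z(i := (X i \<omega>, 0))) \<partial>M) \<partial>?N)"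
  proof (rule integral_cong_AE)
    have X0: "(\<lambda>(z, \<omega>). H (z(i := (X i \<omega>, 0)))) \<in> borel_measurable (?P \<Otimes>\<^sub>M M)"
    proof -
      have "(\<lambda>(z, \<omega>). (z, (X i \<omega>, 0::real))) \<in> measurable (?P \<Otimes>\<^sub>M M) (?P \<Otimes>\<^sub>M ?B)"
        unfolding borel_prod[symmetric] by measurable
      from measurable_compose[OF this upd] show ?thesis by (simp add: case_prod_unfold)
    qed
    show "(\<lambda>z. \<integral>\<omega>. H (z(i := (X i \<omega>, 0))) * \<phi> (e i \<omega>) \<partial>M) \<in> borel_measurable ?N"
      using X0 by measurable
    show "(\<lambda>z. k * (\<integral>\<omega>. H (z(i := (X i \<omega>, 0))) \<partial>M)) \<in> borel_measurable ?N"
      using X0 by measurable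
    show "AE z in ?N. (\<integral>\<omega>. H (z(i := (X i \<omega>, 0))) * \<phi> (e i \<omega>) \<partial>M)
        = k * (\<integral>\<omega>. H (z(i := (X i \<omega>, 0))) \<partial>M)"
      using fubini_AE[OF int2 \<phi>] AE_space by eventually_elim (rule inner)
  qed
  also have "\<dots> = k * expectation (\<lambda>\<omega>. H (\<lambda>j\<in>I. (X j \<omega>, e j \<omega>)))"
    using fubini[of "\<lambda>_. 1"] int1 by simp
  finally show ?thesis .
qed

section \<open>A self-normalised Bernstein bound\<close>

context prob_space
begin

context
  fixes X e :: "'i \<Rightarrow> 'a \<Rightarrow> real" and I :: "'i set" and B :: real
  assumes I: "finite I"
    and ind: "indep_vars (\<lambda>_. borel :: (real \<times> real) measure) (\<lambda>i \<omega>. (X i \<omega>, e i \<omega>)) I"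
    and mean0: "\<And>i. i \<in> I \<Longrightarrow> AE \<omega> in M. real_cond_exp M (sigma_of M (X i)) (e i) \<omega> = 0"
    and var1: "\<And>i. i \<in> I \<Longrightarrow> AE \<omega> in M. real_cond_exp M (sigma_of M (X i)) (\<lambda>\<omega>. (e i \<omega>)\<^sup>2) \<omega> = 1"
    and B: "0 < B" and bounded: "\<And>i. i \<in> I \<Longrightarrow> AE \<omega> in M. \<bar>e i \<omega>\<bar> \<le> B"
begin

lemma covariate_noise_measurable:
  assumes "i \<in> I"
  shows "X i \<in> borel_measurable M" "e i \<in> borel_measurable M"
proof -
  have Z: "(\<lambda>\<omega>. (X i \<omega>, e i \<omega>)) \<in> borel_measurable M"
    using ind assms by (auto simp: indep_vars_def)
  show "X i \<in> borel_measurable M" "e i \<in> borel_measurable M"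
    using measurable_compose[OF Z borel_measurable_continuous_onI[of fst]]
      measurable_compose[OF Z borel_measurable_continuous_onI[of snd]]
    by (auto simp: continuous_on_fst continuous_on_snd)
qed

lemma covariates_measurable: "(\<lambda>\<omega>. \<lambda>j\<in>I. X j \<omega>) \<in> measurable M (Pi\<^sub>M I (\<lambda>_. borel))"
  by (intro measurable_restrict covariate_noise_measurable)

text \<open>
  The coefficients \<open>c i\<close> may depend on all covariates, so the summands are not independent and the
  exponential moment does not factor. The noise terms are removed one at a time instead: in the
  step for index \<open>i\<close>, \<open>exp_le_quadratic\<close> bounds \<open>exp (c i * e i)\<close> by \<open>1 + c i * e i + (c i * e i)\<^sup>2\<close>,
  where given everything else \<open>e i\<close> has mean \<open>0\<close> and second moment \<open>1\<close>. There remains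
  \<open>1 + (c i)\<^sup>2 \<le> exp ((c i)\<^sup>2)\<close>, which the compensator cancels.
\<close>

lemma expectation_exp_noise_le_1:
  assumes f: "\<And>i. i \<in> I \<Longrightarrow> f i \<in> borel_measurable (Pi\<^sub>M I (\<lambda>_. borel))"
    and fB: "\<And>i x. i \<in> I \<Longrightarrow> \<bar>f i x\<bar> * B \<le> 3 / 2"
  defines "c \<equiv> \<lambda>i \<omega>. f i (\<lambda>j\<in>I. X j \<omega>)"
  shows "integrable M (\<lambda>\<omega>. exp (\<Sum>i\<in>I. c i \<omega> * e i \<omega> - (c i \<omega>)\<^sup>2))"
    and "expectation (\<lambda>\<omega>. exp (\<Sum>i\<in>I. c i \<omega> * e i \<omega> - (c i \<omega>)\<^sup>2)) \<le> 1"
proof -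
  have c: "c i \<in> borel_measurable M" if "i \<in> I" for i
    unfolding c_def by (rule measurable_compose[OF covariates_measurable f[OF that]])
  have e: "e i \<in> borel_measurable M" if "i \<in> I" for i
    using covariate_noise_measurable[OF that] by simp
  have cB: "\<bar>c i \<omega>\<bar> * B \<le> 3 / 2" if "i \<in> I" for i \<omega>
    using fB[OF that] by (simp add: c_def)
  have ce: "AE \<omega> in M. \<forall>i\<in>I. \<bar>c i \<omega> * e i \<omega>\<bar> \<le> 3 / 2"
  proof -
    have "AE \<omega> in M. \<bar>c i \<omega> * e i \<omega>\<bar> \<le> 3 / 2" if "i \<in> I" for i
      using bounded[OF that]
    proof eventually_elim
      case (elim \<omega>)
      then have "\<bar>c i \<omega>\<bar> * \<bar>e i \<omega>\<bar> \<le> \<bar>c i \<omega>\<bar> * B" by (intro mult_left_mono) auto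
      with cB[OF that, of \<omega>] show ?case by (simp add: abs_mult)
    qed
    then show ?thesis using I by (simp add: AE_finite_all)
  qed
  define W where "W J \<omega> = exp (\<Sum>i\<in>J. c i \<omega> * e i \<omega> - (c i \<omega>)\<^sup>2)" for J \<omega>
  have W [measurable]: "W J \<in> borel_measurable M" if "J \<subseteq> I" for J
  proof -
    have "(\<lambda>\<omega>. \<Sum>i\<in>J. c i \<omega> * e i \<omega> - (c i \<omega>)\<^sup>2) \<in> borel_measurable M"
      using that c e
      by (intro borel_measurable_sum borel_measurable_diff borel_measurable_times borel_measurable_power) auto
    then show ?thesis unfolding W_def[abs_def] by measurable
  qed
  have W_pos: "0 < W J \<omega>" for J \<omega>
    by (simp add: W_def)
  have W_bound: "AE \<omega> in M. W J \<omega> \<le> exp (real (card J) * (3 / 2))" if "J \<subseteq> I" for J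
    using ce
  proof eventually_elim
    case (elim \<omega>)
    have "(\<Sum>i\<in>J. c i \<omega> * e i \<omega> - (c i \<omega>)\<^sup>2) \<le> (\<Sum>i\<in>J. 3 / 2)"
    proof (rule sum_mono)
      fix i assume "i \<in> J"
      then have "\<bar>c i \<omega> * e i \<omega>\<bar> \<le> 3 / 2" using elim that by auto
      then show "c i \<omega> * e i \<omega> - (c i \<omega>)\<^sup>2 \<le> 3 / 2" using zero_le_power2[of "c i \<omega>"] by linarith
    qed
    then show ?case by (simp add: W_def)
  qed
  have W_int: "integrable M (W J)" if "J \<subseteq> I" for J
    using W_bound[OF that] W[OF that]
    by (intro integrable_const_bound[where B = "exp (real (card J) * (3 / 2))"])
      (simp_all add: abs_of_pos[OF W_pos])
  have "expectation (W J) \<le> 1" if "finite J" "J \<subseteq> I" for J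
    using that
  proof (induction J rule: finite_induct)
    case empty
    then show ?case by (simp add: W_def prob_space)
  next
    case (insert i J)
    then have i: "i \<in> I" "i \<notin> J" and J: "J \<subseteq> I" by auto
    \<comment> \<open>\<open>H\<close> and \<open>F\<close> are the remaining factor and the coefficient \<open>c i\<close> as functions of the sample of
      pairs; neither looks at the noise \<open>e i\<close>.\<close>
    define H where "H z = exp (\<Sum>j\<in>J. f j (\<lambda>j\<in>I. fst (z j)) * snd (z j) - (f j (\<lambda>j\<in>I. fst (z j)))\<^sup>2)
        * exp (- (f i (\<lambda>j\<in>I. fst (z j)))\<^sup>2)" for z :: "'i \<Rightarrow> real \<times> real"
    define F where "F z = f i (\<lambda>j\<in>I. fst (z j))" for z :: "'i \<Rightarrow> real \<times> real"
    let ?Z = "\<lambda>\<omega>. \<lambda>j\<in>I. (X j \<omega>, e j \<omega>)"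
    let ?PZ = "Pi\<^sub>M I (\<lambda>_. borel :: (real \<times> real) measure)"
    have fst_m: "fst \<in> borel_measurable (borel :: (real \<times> real) measure)"
      and snd_m: "snd \<in> borel_measurable (borel :: (real \<times> real) measure)"
      by (simp_all add: borel_measurable_continuous_onI continuous_on_fst continuous_on_snd)
    have proj: "(\<lambda>z. \<lambda>j\<in>I. fst (z j)) \<in> measurable ?PZ (Pi\<^sub>M I (\<lambda>_. borel))"
      by (intro measurable_restrict measurable_compose[OF _ fst_m] measurable_component_singleton)
    have fZ: "(\<lambda>z. f j (\<lambda>j\<in>I. fst (z j))) \<in> borel_measurable ?PZ" if "j \<in> I" for j
      by (rule measurable_compose[OF proj f[OF that]])
    have sZ: "(\<lambda>z. snd (z j)) \<in> borel_measurable ?PZ" if "j \<in> I" for j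
      by (intro measurable_compose[OF _ snd_m] measurable_component_singleton that)
    have F [measurable]: "F \<in> borel_measurable ?PZ"
      unfolding F_def by (rule fZ[OF i(1)])
    have H [measurable]: "H \<in> borel_measurable ?PZ"
    proof -
      have "(\<lambda>z. \<Sum>j\<in>J. f j (\<lambda>j\<in>I. fst (z j)) * snd (z j) - (f j (\<lambda>j\<in>I. fst (z j)))\<^sup>2)
          \<in> borel_measurable ?PZ"
        using J fZ sZ
        by (intro borel_measurable_sum borel_measurable_diff borel_measurable_times borel_measurable_power) auto
      moreover note fZ[OF i(1)]
      ultimately show ?thesis unfolding H_def[abs_def] by measurable
    qed
    have restr: "(\<lambda>j\<in>I. fst ((z(i := (fst (z i), y))) j)) = (\<lambda>j\<in>I. fst (z j))" for z :: "'i \<Rightarrow> real \<times> real" and y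
      by auto
    have ignF: "F (z(i := (fst (z i), y))) = F z" for z y
      unfolding F_def restr ..
    have ignH: "H (z(i := (fst (z i), y))) = H z" for z y
    proof -
      have "snd ((z(i := (fst (z i), y))) j) = snd (z j)" if "j \<in> J" for j
        using that i by auto
      then show ?thesis unfolding H_def restr by simp
    qed
    have covs: "(\<lambda>j\<in>I. fst (?Z \<omega> j)) = (\<lambda>j\<in>I. X j \<omega>)" for \<omega>
      by auto
    have FZ: "F (?Z \<omega>) = c i \<omega>" for \<omega>
      unfolding F_def covs c_def ..
    have "(\<Sum>j\<in>J. c j \<omega> * snd (?Z \<omega> j) - (c j \<omega>)\<^sup>2) = (\<Sum>j\<in>J. c j \<omega> * e j \<omega> - (c j \<omega>)\<^sup>2)" for \<omega>
      using J by (intro sum.cong) auto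
    then have HZ: "H (?Z \<omega>) = W J \<omega> * exp (- (c i \<omega>)\<^sup>2)" for \<omega>
      unfolding H_def covs W_def c_def by simp
    have W0: "0 \<le> W J \<omega>" for \<omega> using W_pos[of J \<omega>] by simp
    have [measurable]: "c i \<in> borel_measurable M" "e i \<in> borel_measurable M" "W J \<in> borel_measurable M"
      using c e i W J by auto
    define V where "V \<omega> = W J \<omega> * exp (- (c i \<omega>)\<^sup>2)" for \<omega>
    have V [measurable]: "V \<in> borel_measurable M" unfolding V_def by measurable
    have V0: "0 \<le> V \<omega>" for \<omega> using W0 by (simp add: V_def)
    have V_le: "V \<omega> \<le> W J \<omega>" for \<omega>
      using W0[of \<omega>] mult_left_mono[of "exp (- (c i \<omega>)\<^sup>2)" 1 "W J \<omega>"] by (simp add: V_def)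
    have intV: "integrable M (\<lambda>\<omega>. V \<omega> * g \<omega>)"
      if [measurable]: "g \<in> borel_measurable M" and g: "AE \<omega> in M. \<bar>g \<omega>\<bar> \<le> D" for g D
    proof (rule Bochner_Integration.integrable_bound[OF integrable_mult_left[OF W_int[OF J], of D]])
      show "(\<lambda>\<omega>. V \<omega> * g \<omega>) \<in> borel_measurable M" by measurable
      show "AE \<omega> in M. norm (V \<omega> * g \<omega>) \<le> norm (W J \<omega> * D)"
        using g by eventually_elim (use V0 V_le W0 in \<open>auto simp: abs_mult intro!: mult_mono\<close>)
    qed
    have ci: "\<bar>c i \<omega>\<bar> \<le> 3 / 2 / B" for \<omega>
      using cB[OF i(1), of \<omega>] B by (simp add: field_simps)
    have ci2: "\<bar>(c i \<omega>)\<^sup>2\<bar> \<le> (3 / 2 / B)\<^sup>2" for \<omega>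
      using power_mono[OF ci[of \<omega>], of 2] by simp
    have cei: "AE \<omega> in M. \<bar>c i \<omega> * e i \<omega>\<bar> \<le> 3 / 2"
      using ce i by auto
    have cei2: "AE \<omega> in M. \<bar>(c i \<omega>)\<^sup>2 * (e i \<omega>)\<^sup>2\<bar> \<le> (3 / 2)\<^sup>2"
      using cei
    proof eventually_elim
      case (elim \<omega>)
      from power_mono[OF this, of 2] show ?case by (simp add: power_mult_distrib)
    qed
    have int0: "integrable M V"
      using intV[of "\<lambda>_. 1" 1] by simp
    have int1: "integrable M (\<lambda>\<omega>. V \<omega> * c i \<omega>)"
      by (rule intV[of _ "3 / 2 / B"]) (use ci in auto)
    have int2: "integrable M (\<lambda>\<omega>. V \<omega> * (c i \<omega>)\<^sup>2)"
      by (rule intV[of _ "(3 / 2 / B)\<^sup>2"]) (use ci2 in auto)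
    have int1e: "integrable M (\<lambda>\<omega>. V \<omega> * (c i \<omega> * e i \<omega>))"
      by (rule intV[of _ "3 / 2"]) (use cei in auto)
    have int2e: "integrable M (\<lambda>\<omega>. V \<omega> * ((c i \<omega>)\<^sup>2 * (e i \<omega>)\<^sup>2))"
      by (rule intV[of _ "(3 / 2)\<^sup>2"]) (use cei2 in auto)
    have m1: "expectation (\<lambda>\<omega>. V \<omega> * (c i \<omega> * e i \<omega>)) = 0"
      using expectation_mult_noise[OF ind i(1), of "\<lambda>t. t" 0 "\<lambda>z. H z * F z"] mean0[OF i(1)] int1 int1e
      by (simp add: HZ FZ ignH ignF V_def mult.assoc)
    have m2: "expectation (\<lambda>\<omega>. V \<omega> * ((c i \<omega>)\<^sup>2 * (e i \<omega>)\<^sup>2)) = expectation (\<lambda>\<omega>. V \<omega> * (c i \<omega>)\<^sup>2)"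
      using expectation_mult_noise[OF ind i(1), of "\<lambda>t. t\<^sup>2" 1 "\<lambda>z. H z * (F z)\<^sup>2"] var1[OF i(1)] int2 int2e
      by (simp add: HZ FZ ignH ignF V_def mult.assoc)
    have WV: "W (insert i J) \<omega> = V \<omega> * exp (c i \<omega> * e i \<omega>)" for \<omega>
      using insert.hyps by (simp add: W_def V_def exp_diff exp_add exp_minus field_simps)
    have "expectation (W (insert i J))
        \<le> expectation (\<lambda>\<omega>. V \<omega> + V \<omega> * (c i \<omega> * e i \<omega>) + V \<omega> * ((c i \<omega>)\<^sup>2 * (e i \<omega>)\<^sup>2))"
    proof (rule integral_mono_AE)
      show "AE \<omega> in M. W (insert i J) \<omega>
          \<le> V \<omega> + V \<omega> * (c i \<omega> * e i \<omega>) + V \<omega> * ((c i \<omega>)\<^sup>2 * (e i \<omega>)\<^sup>2)"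
        using cei
      proof eventually_elim
        case (elim \<omega>)
        from mult_left_mono[OF exp_le_quadratic[OF elim] V0[of \<omega>]]
        show ?case by (simp add: WV algebra_simps power_mult_distrib)
      qed
    qed (use insert.prems W_int int0 int1e int2e in auto)
    also have "\<dots> = expectation (\<lambda>\<omega>. V \<omega> + V \<omega> * (c i \<omega>)\<^sup>2)"
      using int0 int1e int2e int2 m1 m2 by simp
    also have "\<dots> \<le> expectation (W J)"
    proof (rule integral_mono)
      fix \<omega>
      have "exp (- (c i \<omega>)\<^sup>2) * (1 + (c i \<omega>)\<^sup>2) \<le> 1"
        using exp_ge_add_one_self[of "(c i \<omega>)\<^sup>2"] by (simp add: exp_minus field_simps)
      from mult_left_mono[OF this W0[of \<omega>]]
      show "V \<omega> + V \<omega> * (c i \<omega>)\<^sup>2 \<le> W J \<omega>" by (simp add: V_def algebra_simps)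
    qed (use int0 int2 W_int J in auto)
    also have "\<dots> \<le> 1" using insert.IH J by simp
    finally show ?case .
  qed
  from this[OF I] W_int[of I]
  show "integrable M (\<lambda>\<omega>. exp (\<Sum>i\<in>I. c i \<omega> * e i \<omega> - (c i \<omega>)\<^sup>2))"
    and "expectation (\<lambda>\<omega>. exp (\<Sum>i\<in>I. c i \<omega> * e i \<omega> - (c i \<omega>)\<^sup>2)) \<le> 1"
    unfolding W_def[abs_def] by auto
qed

text \<open>
  The exponential bound is applied to the weights rescaled by \<open>sqrt (L / (2 * s2))\<close>, where \<open>s2\<close> is their
  sum of squares. This normalises the compensator to \<open>L / 2\<close>, and the smallness condition is
  exactly what keeps the rescaled summands at most \<open>3 / 2\<close>. On the event the exponent is at least
  \<open>3 / 2 * L - L / 2 = L\<close>, so that Markov's inequality gives \<open>exp (- L)\<close>. The scale is random, but it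
  depends on the covariates only, which is why no conditioning is needed. Where \<open>G\<close> fails the
  rescaled weights are set to \<open>0\<close>.
\<close>

lemma self_normalized_upper_tail:
  fixes w :: "'i \<Rightarrow> ('i \<Rightarrow> real) \<Rightarrow> real" and L :: real
  assumes w: "\<And>i. i \<in> I \<Longrightarrow> w i \<in> borel_measurable (Pi\<^sub>M I (\<lambda>_. borel))"
    and G: "Measurable.pred (Pi\<^sub>M I (\<lambda>_. borel)) G"
    and L: "0 < L"
    and pos: "\<And>x. G x \<Longrightarrow> 0 < (\<Sum>i\<in>I. (w i x)\<^sup>2)"
    and small: "\<And>x i. G x \<Longrightarrow> i \<in> I \<Longrightarrow> \<bar>w i x\<bar> * B \<le> 3 / sqrt 2 * sqrt ((\<Sum>i\<in>I. (w i x)\<^sup>2) / L)"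
  defines "Xr \<equiv> \<lambda>\<omega>. \<lambda>j\<in>I. X j \<omega>"
  defines "D \<equiv> {\<omega>\<in>space M. G (Xr \<omega>) \<and>
      (\<Sum>i\<in>I. w i (Xr \<omega>) * e i \<omega>) > 3 / sqrt 2 * sqrt (L * (\<Sum>i\<in>I. (w i (Xr \<omega>))\<^sup>2))}"
  shows "D \<in> events" and "prob D \<le> exp (- L)"
proof -
  define s2 where "s2 x = (\<Sum>i\<in>I. (w i x)\<^sup>2)" for x
  have s2 [measurable]: "s2 \<in> borel_measurable (Pi\<^sub>M I (\<lambda>_. borel))"
    unfolding s2_def by (intro borel_measurable_sum borel_measurable_power w)
  define f where "f i x = (if G x then sqrt (L / (2 * s2 x)) * w i x else 0)" for i x
  have f: "f i \<in> borel_measurable (Pi\<^sub>M I (\<lambda>_. borel))" if "i \<in> I" for i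
    unfolding f_def using w[OF that] G by measurable
  have fB: "\<bar>f i x\<bar> * B \<le> 3 / 2" if "i \<in> I" for i x
  proof (cases "G x")
    case True
    note p = pos[OF True, folded s2_def]
    have "\<bar>f i x\<bar> * B = sqrt (L / (2 * s2 x)) * (\<bar>w i x\<bar> * B)"
      using True p L by (simp add: f_def abs_mult)
    also have "\<dots> \<le> sqrt (L / (2 * s2 x)) * (3 / sqrt 2 * sqrt (s2 x / L))"
      using small[OF True that, folded s2_def] p L by (intro mult_left_mono) auto
    also have "\<dots> = 3 / sqrt 2 * sqrt (L / (2 * s2 x) * (s2 x / L))"
      by (simp only: real_sqrt_mult mult_ac)
    also have "L / (2 * s2 x) * (s2 x / L) = 1 / 2"
      using p L by (simp add: field_simps)
    also have "3 / sqrt 2 * sqrt (1 / 2) = (3 / 2 :: real)"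
      by (simp add: real_sqrt_divide)
    finally show ?thesis by simp
  qed (simp add: f_def)
  have Xr: "Xr \<in> measurable M (Pi\<^sub>M I (\<lambda>_. borel))"
    unfolding Xr_def by (rule covariates_measurable)
  have [measurable]: "Measurable.pred M (\<lambda>\<omega>. G (Xr \<omega>))"
    using measurable_compose[OF Xr G] by simp
  have [measurable]: "(\<lambda>\<omega>. s2 (Xr \<omega>)) \<in> borel_measurable M"
    using measurable_compose[OF Xr s2] by simp
  have [measurable]: "(\<lambda>\<omega>. \<Sum>i\<in>I. w i (Xr \<omega>) * e i \<omega>) \<in> borel_measurable M"
    using measurable_compose[OF Xr w] covariate_noise_measurable
    by (intro borel_measurable_sum borel_measurable_times) auto
  show D: "D \<in> events"
    unfolding D_def s2_def[symmetric] by measurable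
  let ?W = "\<lambda>\<omega>. exp (\<Sum>i\<in>I. f i (Xr \<omega>) * e i \<omega> - (f i (Xr \<omega>))\<^sup>2)"
  have W: "integrable M ?W" "expectation ?W \<le> 1"
    unfolding Xr_def by (rule expectation_exp_noise_le_1[of f]; fact f fB)+
  have int_D: "integrable M (indicator D :: 'a \<Rightarrow> real)"
    using D by (intro integrable_real_indicator) (auto simp: less_top[symmetric])
  have "prob D = expectation (indicator D)"
    using D by simp
  also have "\<dots> \<le> expectation (\<lambda>\<omega>. exp (- L) * ?W \<omega>)"
  proof (rule integral_mono)
    fix \<omega>
    show "indicator D \<omega> \<le> exp (- L) * ?W \<omega>"
    proof (cases "\<omega> \<in> D")
      case True
      then have g: "G (Xr \<omega>)"
        and big: "3 / sqrt 2 * sqrt (L * s2 (Xr \<omega>)) < (\<Sum>i\<in>I. w i (Xr \<omega>) * e i \<omega>)"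
        by (auto simp: D_def s2_def)
      note p = pos[OF g, folded s2_def]
      let ?r = "sqrt (L / (2 * s2 (Xr \<omega>)))"
      have "(\<Sum>i\<in>I. (f i (Xr \<omega>))\<^sup>2) = ?r\<^sup>2 * s2 (Xr \<omega>)"
        using g by (simp add: f_def s2_def power_mult_distrib sum_distrib_left)
      also have "\<dots> = L / 2"
        using p L by simp
      finally have sq: "(\<Sum>i\<in>I. (f i (Xr \<omega>))\<^sup>2) = L / 2" .
      have "3 / 2 * L = ?r * (3 / sqrt 2 * sqrt (L * s2 (Xr \<omega>)))"
      proof -
        have "?r * (3 / sqrt 2 * sqrt (L * s2 (Xr \<omega>))) = 3 / sqrt 2 * sqrt (L / (2 * s2 (Xr \<omega>)) * (L * s2 (Xr \<omega>)))"
          by (simp only: real_sqrt_mult mult_ac)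
        also have "L / (2 * s2 (Xr \<omega>)) * (L * s2 (Xr \<omega>)) = L\<^sup>2 / 2"
          using p by (simp add: power2_eq_square)
        also have "3 / sqrt 2 * sqrt (L\<^sup>2 / 2) = 3 / 2 * L"
          using L by (simp add: real_sqrt_divide)
        finally show ?thesis ..
      qed
      also have "\<dots> \<le> ?r * (\<Sum>i\<in>I. w i (Xr \<omega>) * e i \<omega>)"
        using big p L by (intro mult_left_mono) auto
      also have "\<dots> = (\<Sum>i\<in>I. f i (Xr \<omega>) * e i \<omega>)"
        using g by (simp add: f_def sum_distrib_left mult.assoc)
      finally have "0 \<le> - L + (\<Sum>i\<in>I. f i (Xr \<omega>) * e i \<omega> - (f i (Xr \<omega>))\<^sup>2)"
        by (simp add: sum_subtractf sq)
      then have "1 \<le> exp (- L + (\<Sum>i\<in>I. f i (Xr \<omega>) * e i \<omega> - (f i (Xr \<omega>))\<^sup>2))"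
        by simp
      moreover have "indicator D \<omega> = (1 :: real)" using True by simp
      ultimately show ?thesis by (simp only: exp_add)
    qed simp
  qed (use int_D W in auto)
  also have "\<dots> \<le> exp (- L) * 1"
    using W by simp
  finally show "prob D \<le> exp (- L)" by simp
qed

lemma self_normalized_tail:
  fixes w :: "'i \<Rightarrow> ('i \<Rightarrow> real) \<Rightarrow> real" and L :: real
  assumes w: "\<And>i. i \<in> I \<Longrightarrow> w i \<in> borel_measurable (Pi\<^sub>M I (\<lambda>_. borel))"
    and G: "Measurable.pred (Pi\<^sub>M I (\<lambda>_. borel)) G"
    and L: "0 < L"
    and pos: "\<And>x. G x \<Longrightarrow> 0 < (\<Sum>i\<in>I. (w i x)\<^sup>2)"
    and small: "\<And>x i. G x \<Longrightarrow> i \<in> I \<Longrightarrow> \<bar>w i x\<bar> * B \<le> 3 / sqrt 2 * sqrt ((\<Sum>i\<in>I. (w i x)\<^sup>2) / L)"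
  defines "Xr \<equiv> \<lambda>\<omega>. \<lambda>j\<in>I. X j \<omega>"
  defines "D \<equiv> {\<omega>\<in>space M. G (Xr \<omega>) \<and>
      \<bar>\<Sum>i\<in>I. w i (Xr \<omega>) * e i \<omega>\<bar> > 3 / sqrt 2 * sqrt (L * (\<Sum>i\<in>I. (w i (Xr \<omega>))\<^sup>2))}"
  shows "D \<in> events" and "prob D \<le> 2 * exp (- L)"
proof -
  have D_eq: "D = {\<omega>\<in>space M. G (Xr \<omega>) \<and>
      (\<Sum>i\<in>I. w i (Xr \<omega>) * e i \<omega>) > 3 / sqrt 2 * sqrt (L * (\<Sum>i\<in>I. (w i (Xr \<omega>))\<^sup>2))} \<union>
    {\<omega>\<in>space M. G (Xr \<omega>) \<and>
      (\<Sum>i\<in>I. - w i (Xr \<omega>) * e i \<omega>) > 3 / sqrt 2 * sqrt (L * (\<Sum>i\<in>I. (w i (Xr \<omega>))\<^sup>2))}" (is "_ = ?U \<union> ?V")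
    unfolding D_def by (auto simp: sum_negf abs_if split: if_splits)
  have U: "?U \<in> events" "prob ?U \<le> exp (- L)"
    unfolding Xr_def by (rule self_normalized_upper_tail[OF w G L pos small]; assumption)+
  have V: "?V \<in> events" "prob ?V \<le> exp (- L)"
    using self_normalized_upper_tail[of "\<lambda>i x. - w i x" G L, unfolded power2_minus abs_minus_cancel,
        OF borel_measurable_uminus[OF w] G L pos small]
    unfolding Xr_def by blast+
  show "D \<in> events" unfolding D_eq using U(1) V(1) by blast
  show "prob D \<le> 2 * exp (- L)"
    unfolding D_eq using measure_Un_le[of ?U M ?V] U V by linarith
qed

end
end

section \<open>Coverage\<close>

text \<open>
  The deterministic half of the argument, for one realisation. The weights sum to \<open>1\<close>, hence the
  error of the estimator is bias plus noise, at most \<open>(1 / 2 + 3 / sqrt 2) * \<sigma> * sqrt (L * s)\<close> with \<open>s\<close> the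
  sum of squares for the bandwidths \<open>g\<close>, \<open>l\<close>. The ratio condition makes the radius at least
  \<open>sqrt 8 * \<sigma> * sqrt (L * s)\<close>, and \<open>1 / 2 + 3 / sqrt 2 \<le> sqrt 8\<close>.
\<close>

lemma rbc_interval_covers:
  assumes ex: "rbc_exists K p n g l x"
    and \<sigma>: "0 < \<sigma>" and L: "0 < L" and L': "0 < L'"
    and model: "\<And>i. i \<in> {1..n} \<Longrightarrow> y i = m (x i) + \<sigma> * \<epsilon> i"
    and bias: "\<bar>rbc_bias K p n g l m x\<bar> / sqrt (rbc_sumsq K p n g l x) \<le> sqrt (\<sigma>\<^sup>2 / 4 * L)"
    and noise: "\<bar>\<Sum>i=1..n. rbc_weight K p n g l x i * \<epsilon> i\<bar> \<le> 3 / sqrt 2 * sqrt (L * rbc_sumsq K p n g l x)"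
    and ex': "rbc_exists K p n h b x"
    and ratio: "rbc_sumsq K p n g l x / rbc_sumsq K p n h b x \<le> L' / (4 * L)"
  shows "\<bar>rbc_estimator K p n g l x y - m 0\<bar> \<le> \<sigma> * sqrt (2 * L' * rbc_sumsq K p n h b x)"
proof -
  let ?w = "rbc_weight K p n g l x" and ?s = "rbc_sumsq K p n g l x" and ?t = "rbc_sumsq K p n h b x"
  have s: "0 < ?s" and t: "0 < ?t"
    using rbc_sumsq_pos[OF ex] rbc_sumsq_pos[OF ex'] by auto
  have "rbc_estimator K p n g l x y = (\<Sum>i=1..n. ?w i * (m (x i) - m 0) + \<sigma> * (?w i * \<epsilon> i) + ?w i * m 0)"
    unfolding rbc_estimator_def by (intro sum.cong) (auto simp: model algebra_simps)
  also have "\<dots> = rbc_bias K p n g l m x + \<sigma> * (\<Sum>i=1..n. ?w i * \<epsilon> i) + (\<Sum>i=1..n. ?w i) * m 0"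
    by (simp add: sum.distrib rbc_bias_def sum_distrib_left sum_distrib_right)
  finally have "rbc_estimator K p n g l x y - m 0 = rbc_bias K p n g l m x + \<sigma> * (\<Sum>i=1..n. ?w i * \<epsilon> i)"
    using sum_rbc_weight[OF ex] by simp
  then have "\<bar>rbc_estimator K p n g l x y - m 0\<bar>
      \<le> \<bar>rbc_bias K p n g l m x\<bar> + \<sigma> * \<bar>\<Sum>i=1..n. ?w i * \<epsilon> i\<bar>"
    using abs_triangle_ineq[of "rbc_bias K p n g l m x" "\<sigma> * (\<Sum>i=1..n. ?w i * \<epsilon> i)"] \<sigma>
    by (simp add: abs_mult)
  also have "\<dots> \<le> \<sigma> / 2 * sqrt (L * ?s) + \<sigma> * (3 / sqrt 2 * sqrt (L * ?s))"
  proof (intro add_mono mult_left_mono noise)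
    have "\<bar>rbc_bias K p n g l m x\<bar> \<le> sqrt (\<sigma>\<^sup>2 / 4 * L) * sqrt ?s"
      using bias s by (simp add: field_simps)
    also have "\<dots> = \<sigma> / 2 * sqrt (L * ?s)"
      using \<sigma> by (simp add: real_sqrt_mult real_sqrt_divide)
    finally show "\<bar>rbc_bias K p n g l m x\<bar> \<le> \<sigma> / 2 * sqrt (L * ?s)" .
  qed (use \<sigma> in simp)
  also have "\<dots> = \<sigma> * ((1 / 2 + 3 / sqrt 2) * sqrt (L * ?s))"
    by (simp add: algebra_simps)
  also have "\<dots> \<le> \<sigma> * (sqrt 8 * sqrt (L * ?s))"
  proof (intro mult_left_mono mult_right_mono)
    have "1 / 2 + 3 / sqrt 2 = 1 / 2 + 3 / 2 * sqrt 2"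
      by (simp add: real_div_sqrt field_simps)
    also have "\<dots> \<le> 2 * sqrt 2"
    proof -
      have "1 \<le> sqrt (2 :: real)" by simp
      then show ?thesis by linarith
    qed
    also have "\<dots> = sqrt 8"
      using real_sqrt_mult[of 4 2] by simp
    finally show "1 / 2 + 3 / sqrt 2 \<le> sqrt 8" .
  qed (use \<sigma> L s in auto)
  also have "\<dots> = \<sigma> * sqrt (2 * (4 * L * ?s))"
    by (simp flip: real_sqrt_mult add: mult.assoc)
  also have "\<dots> \<le> \<sigma> * sqrt (2 * (L' * ?t))"
  proof -
    have "4 * L * ?s \<le> L' * ?t"
      using ratio L t by (simp add: field_simps)
    then show ?thesis using \<sigma> by simp
  qed
  finally show ?thesis by (simp add: mult.assoc)
qed

theorem proposition3:
  fixes P :: "'w measure"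
    and X Y eps :: "nat \<Rightarrow> 'w \<Rightarrow> real"
    and m V fX K rS :: "real \<Rightarrow> real"
    and lo hi CS vs E \<sigma> B \<alpha> h b g l :: real
    and n p S :: nat
    and \<A> \<B> \<C> :: "'w set"
  assumes "n \<ge> 1" and "p \<ge> 1" and "S > p + 1"
    and "regression_model P n lo hi m V X Y eps"
    and "design_assumption P n lo hi fX X Y"
    and "smoothness_assumption n lo hi S CS rS m V"
    and "moment_assumption P n S vs E X eps"
    and "kernel_assumption K"
    and "\<sigma> > 0" and "B > 0"
    and "\<forall>i\<in>{1..n}. AE \<omega> in P. \<bar>eps i \<omega>\<bar> \<le> B"
    and "\<forall>x\<in>{lo..hi}. V x = \<sigma>\<^sup>2"
    and "0 < \<alpha>" and "\<alpha> < 1"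
    and "h = real n powr (- 1 / (2 * real p + 3))" and "b = h"
    and "g = (ln (real n) / real n) powr (1 / (2 * real p + 3))" and "l = g"
    and "\<A> = {\<omega>\<in>space P. rbc_exists K p n g l (\<lambda>i. X i \<omega>) \<longrightarrow>
           rbc_maxabs K p n g l (\<lambda>i. X i \<omega>) / sqrt (rbc_sumsq K p n g l (\<lambda>i. X i \<omega>))
             > 3 * sqrt 2 / (2 * B * sqrt (ln (2 / \<alpha>)))}"
    and "\<B> = {\<omega>\<in>space P. rbc_exists K p n g l (\<lambda>i. X i \<omega>) \<longrightarrow>
           \<bar>rbc_bias K p n g l m (\<lambda>i. X i \<omega>)\<bar> / sqrt (rbc_sumsq K p n g l (\<lambda>i. X i \<omega>))
             > sqrt (\<sigma>\<^sup>2 / 4 * ln (2 / \<alpha>))}"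
    and "\<C> = {\<omega>\<in>space P. rbc_exists K p n g l (\<lambda>i. X i \<omega>) \<and> rbc_exists K p n h b (\<lambda>i. X i \<omega>) \<longrightarrow>
           rbc_sumsq K p n g l (\<lambda>i. X i \<omega>) / rbc_sumsq K p n h b (\<lambda>i. X i \<omega>)
             > ln (1 / \<alpha>) / (4 * ln (2 / \<alpha>))}"
  shows "measure P {\<omega>\<in>space P.
           rbc_exists K p n g l (\<lambda>i. X i \<omega>) \<and> rbc_exists K p n h b (\<lambda>i. X i \<omega>) \<and>
           m 0 \<in> {rbc_estimator K p n g l (\<lambda>i. X i \<omega>) (\<lambda>i. Y i \<omega>)
                     - rbc_radius K p n \<sigma> \<alpha> h b (\<lambda>i. X i \<omega>) ..
                   rbc_estimator K p n g l (\<lambda>i. X i \<omega>) (\<lambda>i. Y i \<omega>)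
                     + rbc_radius K p n \<sigma> \<alpha> h b (\<lambda>i. X i \<omega>)}}
         \<ge> 1 - \<alpha> - 2 * (measure P \<A> + measure P \<B> + measure P \<C>)"
proof -
  note model = assms(4)[unfolded regression_model_def] and design = assms(5)[unfolded design_assumption_def]
  interpret prob_space P using model by blast
  define L where "L = ln (2 / \<alpha>)"
  have L: "0 < L" and \<alpha>_eq: "2 * exp (- L) = \<alpha>"
    using assms(13,14) by (auto simp: L_def exp_minus)
  have L': "0 < ln (1 / \<alpha>)"
    using assms(13,14) by simp
  let ?I = "{1..n}"
  have X: "X i \<in> borel_measurable P" and Y: "Y i \<in> borel_measurable P" and eps: "eps i \<in> borel_measurable P"
    if "i \<in> ?I" for i
    using model that by auto
  have X_range: "X i \<omega> \<in> {lo..hi}" if "i \<in> ?I" "\<omega> \<in> space P" for i \<omega>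
    using design that by blast
  have K: "K \<in> borel_measurable borel"
    using assms(8) lipschitz_on_continuous_on unfolding kernel_assumption_def
    by (blast intro: borel_measurable_continuous_onI)

  \<comment> \<open>The regression function is measurable on \<open>{lo..hi}\<close> only, and the noise \<open>eps\<close> is tied to the pairs
    \<open>(X, Y)\<close> only on the sample space. Independence of the pairs of covariate and noise is therefore
    derived for the reconstruction \<open>e\<close> of the noise as a Borel function of \<open>(X, Y)\<close>.\<close>
  define m' where "m' x = indicator {lo..hi} x *\<^sub>R m x" for x
  have m': "m' \<in> borel_measurable borel"
  proof -
    have "m \<in> borel_measurable (restrict_space borel {lo..hi})" using model by blast
    then show ?thesis unfolding m'_def[abs_def] by (subst (asm) borel_measurable_restrict_space_iff) auto
  qed
  have m'_X: "m' (X i \<omega>) = m (X i \<omega>)" if "i \<in> ?I" "\<omega> \<in> space P" for i \<omega>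
    using X_range[OF that] by (simp add: m'_def)
  have Y_eq: "Y i \<omega> = m (X i \<omega>) + \<sigma> * eps i \<omega>" if "i \<in> ?I" "\<omega> \<in> space P" for i \<omega>
    using model that X_range[OF that] assms(9,12) by auto
  define e where "e i \<omega> = (Y i \<omega> - m' (X i \<omega>)) / \<sigma>" for i \<omega>
  have e_eq: "e i \<omega> = eps i \<omega>" if "i \<in> ?I" "\<omega> \<in> space P" for i \<omega>
    using Y_eq[OF that] m'_X[OF that] assms(9) by (simp add: e_def)
  have e: "e i \<in> borel_measurable P" if "i \<in> ?I" for i
    using eps[OF that] by (subst measurable_cong[OF e_eq[OF that]])
  have ind: "indep_vars (\<lambda>_. borel :: (real \<times> real) measure) (\<lambda>i \<omega>. (X i \<omega>, e i \<omega>)) ?I"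
  proof -
    have "(\<lambda>z. (fst z, (snd z - m' (fst z)) / \<sigma>)) \<in> borel_measurable (borel :: (real \<times> real) measure)"
      using m' unfolding borel_prod[symmetric] by measurable
    from indep_vars_compose2[OF _ this] design show ?thesis
      unfolding e_def by fastforce
  qed
  have mean0: "AE \<omega> in P. real_cond_exp P (sigma_of P (X i)) (e i) \<omega> = 0" if i: "i \<in> ?I" for i
  proof -
    interpret F: finite_measure_subalgebra P "sigma_of P (X i)"
      by (rule sigma_of_subalgebra[OF X[OF i]])
    have "AE \<omega> in P. real_cond_exp P (sigma_of P (X i)) (e i) \<omega> = real_cond_exp P (sigma_of P (X i)) (eps i) \<omega>"
      using e_eq[OF i] e[OF i] eps[OF i] by (intro F.real_cond_exp_cong) auto
    moreover have "AE \<omega> in P. real_cond_exp P (sigma_of P (X i)) (eps i) \<omega> = 0"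
      using model i by blast
    ultimately show ?thesis by eventually_elim simp
  qed
  have var1: "AE \<omega> in P. real_cond_exp P (sigma_of P (X i)) (\<lambda>\<omega>. (e i \<omega>)\<^sup>2) \<omega> = 1" if i: "i \<in> ?I" for i
  proof -
    interpret F: finite_measure_subalgebra P "sigma_of P (X i)"
      by (rule sigma_of_subalgebra[OF X[OF i]])
    have "AE \<omega> in P. real_cond_exp P (sigma_of P (X i)) (\<lambda>\<omega>. (e i \<omega>)\<^sup>2) \<omega>
        = real_cond_exp P (sigma_of P (X i)) (\<lambda>\<omega>. (eps i \<omega>)\<^sup>2) \<omega>"
      using e_eq[OF i] e[OF i] eps[OF i] by (intro F.real_cond_exp_cong) auto
    moreover have "AE \<omega> in P. real_cond_exp P (sigma_of P (X i)) (\<lambda>\<omega>. (eps i \<omega>)\<^sup>2) \<omega> = 1"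
      using model i by blast
    ultimately show ?thesis by eventually_elim simp
  qed
  have bounded: "AE \<omega> in P. \<bar>e i \<omega>\<bar> \<le> B" if i: "i \<in> ?I" for i
  proof -
    have "AE \<omega> in P. \<bar>eps i \<omega>\<bar> \<le> B" using assms(11) i by blast
    with AE_space show ?thesis by eventually_elim (simp add: e_eq[OF i])
  qed

  let ?w = "\<lambda>i x. rbc_weight K p n g l x i"
  \<comment> \<open>\<open>G\<close> is the complement of \<open>\<A>\<close>, read as a condition on the vector of covariates.\<close>
  define G where "G x \<longleftrightarrow> rbc_exists K p n g l x \<and>
    rbc_maxabs K p n g l x / sqrt (rbc_sumsq K p n g l x) \<le> 3 * sqrt 2 / (2 * B * sqrt L)" for x
  define Xr where "Xr \<omega> = (\<lambda>j\<in>?I. X j \<omega>)" for \<omega>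
  define D where "D = {\<omega>\<in>space P. G (Xr \<omega>) \<and>
      \<bar>\<Sum>i\<in>?I. ?w i (Xr \<omega>) * e i \<omega>\<bar> > 3 / sqrt 2 * sqrt (L * (\<Sum>i\<in>?I. (?w i (Xr \<omega>))\<^sup>2))}"
  have coord: "(\<lambda>x. x j) \<in> borel_measurable (Pi\<^sub>M ?I (\<lambda>_. borel :: real measure))" if "j \<in> ?I" for j
    using that by (rule measurable_component_singleton)
  have D: "D \<in> events" "prob D \<le> \<alpha>"
  proof -
    have w: "?w i \<in> borel_measurable (Pi\<^sub>M ?I (\<lambda>_. borel))" if "i \<in> ?I" for i
      using borel_measurable_rbc_weight[where x = "\<lambda>x. x", OF K coord that] by simp
    have G: "Measurable.pred (Pi\<^sub>M ?I (\<lambda>_. borel)) G"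
      unfolding G_def[abs_def]
      using pred_rbc_exists[where x = "\<lambda>x. x", OF K coord, of n p g l]
        borel_measurable_rbc_maxabs[where x = "\<lambda>x. x", OF K coord, of n p g l]
        borel_measurable_rbc_sumsq[where x = "\<lambda>x. x", OF K coord, of n p g l]
      by measurable
    have pos: "0 < (\<Sum>i\<in>?I. (?w i x)\<^sup>2)" if "G x" for x
      using that rbc_sumsq_pos by (auto simp: G_def rbc_sumsq_def)
    have small: "\<bar>?w i x\<bar> * B \<le> 3 / sqrt 2 * sqrt ((\<Sum>i\<in>?I. (?w i x)\<^sup>2) / L)"
      if "G x" "i \<in> ?I" for x i
    proof -
      note s = pos[OF that(1), folded rbc_sumsq_def]
      have "\<bar>?w i x\<bar> \<le> rbc_maxabs K p n g l x"
        unfolding rbc_maxabs_def using that(2) by (intro Max_ge) auto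
      also have "\<dots> \<le> 3 * sqrt 2 / (2 * B * sqrt L) * sqrt (rbc_sumsq K p n g l x)"
        using that(1) s by (simp add: G_def pos_divide_le_eq)
      finally have "\<bar>?w i x\<bar> * B \<le> 3 * sqrt 2 / (2 * B * sqrt L) * sqrt (rbc_sumsq K p n g l x) * B"
        using assms(10) by (intro mult_right_mono) auto
      also have "\<dots> = 3 * (sqrt 2 / 2) * sqrt (rbc_sumsq K p n g l x / L)"
        using assms(10) by (simp add: real_sqrt_divide)
      also have "sqrt 2 / 2 = 1 / sqrt 2"
        by (simp add: field_simps)
      finally show ?thesis by (simp add: rbc_sumsq_def)
    qed
    note tail = self_normalized_tail[of ?I X e B ?w G L,
        OF finite_atLeastAtMost ind mean0 var1 assms(10) bounded w G L pos small,
        folded Xr_def, folded D_def]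
    show "D \<in> events" by (rule tail(1))
    show "prob D \<le> \<alpha>" using tail(2) \<alpha>_eq by simp
  qed
  note [measurable] =
    pred_rbc_exists[where x = "\<lambda>\<omega> i. X i \<omega>", OF K X, of n p]
    borel_measurable_rbc_sumsq[where x = "\<lambda>\<omega> i. X i \<omega>", OF K X, of n p]
    borel_measurable_rbc_maxabs[where x = "\<lambda>\<omega> i. X i \<omega>", OF K X, of n p]
    borel_measurable_rbc_radius[where x = "\<lambda>\<omega> i. X i \<omega>", OF K X, of n p]
    borel_measurable_rbc_estimator[where x = "\<lambda>\<omega> i. X i \<omega>" and y = "\<lambda>\<omega> i. Y i \<omega>", OF K X Y, of n p]
  have bias_m [measurable]: "(\<lambda>\<omega>. rbc_bias K p n g l m (\<lambda>i. X i \<omega>)) \<in> borel_measurable P"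
  proof -
    have "(\<lambda>\<omega>. \<Sum>i=1..n. rbc_weight K p n g l (\<lambda>i. X i \<omega>) i * (m' (X i \<omega>) - m 0)) \<in> borel_measurable P"
      using measurable_compose[OF X m'] borel_measurable_rbc_weight[where x = "\<lambda>\<omega> i. X i \<omega>", OF K X]
      by (intro borel_measurable_sum borel_measurable_times borel_measurable_diff) auto
    then show ?thesis
      by (rule measurable_cong[THEN iffD1, rotated]) (simp add: rbc_bias_def m'_X)
  qed
  have \<A>: "\<A> \<in> events" and \<B>: "\<B> \<in> events" and \<C>: "\<C> \<in> events"
    unfolding assms(19,20,21) by measurable
  let ?cov = "{\<omega>\<in>space P.
      rbc_exists K p n g l (\<lambda>i. X i \<omega>) \<and> rbc_exists K p n h b (\<lambda>i. X i \<omega>) \<and>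
      m 0 \<in> {rbc_estimator K p n g l (\<lambda>i. X i \<omega>) (\<lambda>i. Y i \<omega>)
                - rbc_radius K p n \<sigma> \<alpha> h b (\<lambda>i. X i \<omega>) ..
              rbc_estimator K p n g l (\<lambda>i. X i \<omega>) (\<lambda>i. Y i \<omega>)
                + rbc_radius K p n \<sigma> \<alpha> h b (\<lambda>i. X i \<omega>)}}"
  have cov: "?cov \<in> events"
    unfolding atLeastAtMost_iff by measurable
  have "space P - ?cov \<subseteq> \<A> \<union> \<B> \<union> \<C> \<union> D"
  proof (rule ccontr)
    assume "\<not> ?thesis"
    then obtain \<omega> where \<omega>: "\<omega> \<in> space P" "\<omega> \<notin> ?cov" "\<omega> \<notin> \<A>" "\<omega> \<notin> \<B>" "\<omega> \<notin> \<C>" "\<omega> \<notin> D"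
      by blast
    let ?x = "\<lambda>i. X i \<omega>"
    have w_eq: "rbc_weight K p n g l (Xr \<omega>) i = rbc_weight K p n g l ?x i" if "i \<in> ?I" for i
      using that by (intro rbc_weight_cong) (auto simp: Xr_def)
    have ex: "rbc_exists K p n g l ?x" "rbc_exists K p n h b ?x"
      using \<omega>(1,3,5) unfolding assms(19,21) by auto
    have "G (Xr \<omega>)"
    proof -
      have "rbc_maxabs K p n g l (Xr \<omega>) = rbc_maxabs K p n g l ?x"
        "rbc_sumsq K p n g l (Xr \<omega>) = rbc_sumsq K p n g l ?x"
        unfolding rbc_maxabs_def rbc_sumsq_def using w_eq by (auto intro!: arg_cong[of _ _ Max])
      moreover have "rbc_exists K p n g l (Xr \<omega>) = rbc_exists K p n g l ?x"
        by (rule rbc_exists_cong) (simp add: Xr_def)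
      ultimately show ?thesis
        using \<omega>(1,3) unfolding assms(19) G_def L_def by auto
    qed
    with \<omega>(1,6) have "\<bar>\<Sum>i\<in>?I. ?w i (Xr \<omega>) * e i \<omega>\<bar> \<le> 3 / sqrt 2 * sqrt (L * (\<Sum>i\<in>?I. (?w i (Xr \<omega>))\<^sup>2))"
      unfolding D_def by auto
    then have noise: "\<bar>\<Sum>i=1..n. rbc_weight K p n g l ?x i * eps i \<omega>\<bar> \<le> 3 / sqrt 2 * sqrt (L * rbc_sumsq K p n g l ?x)"
      using e_eq \<omega>(1) w_eq by (simp add: rbc_sumsq_def)
    have "\<bar>rbc_estimator K p n g l ?x (\<lambda>i. Y i \<omega>) - m 0\<bar>
        \<le> \<sigma> * sqrt (2 * ln (1 / \<alpha>) * rbc_sumsq K p n h b ?x)"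
    proof (rule rbc_interval_covers[OF ex(1) assms(9) L L' _ _ noise ex(2)])
      show "Y i \<omega> = m (X i \<omega>) + \<sigma> * eps i \<omega>" if "i \<in> ?I" for i
        using that \<omega>(1) by (rule Y_eq)
      show "\<bar>rbc_bias K p n g l m ?x\<bar> / sqrt (rbc_sumsq K p n g l ?x) \<le> sqrt (\<sigma>\<^sup>2 / 4 * L)"
        using \<omega>(1,4) unfolding assms(20) L_def by auto
      show "rbc_sumsq K p n g l ?x / rbc_sumsq K p n h b ?x \<le> ln (1 / \<alpha>) / (4 * L)"
        using \<omega>(1,5) unfolding assms(21) L_def by auto
    qed
    then show False
      using \<omega>(1,2) ex by (auto simp: rbc_radius_def abs_le_iff)
  qed
  then have "prob (space P - ?cov) \<le> prob (\<A> \<union> \<B> \<union> \<C> \<union> D)"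
    using \<A> \<B> \<C> D by (intro finite_measure_mono) auto
  also have "\<dots> \<le> prob \<A> + prob \<B> + prob \<C> + prob D"
    using measure_Un_le[of "\<A> \<union> \<B> \<union> \<C>" P D] measure_Un_le[of "\<A> \<union> \<B>" P \<C>] measure_Un_le[of \<A> P \<B>] \<A> \<B> \<C> D
    by auto
  finally have "1 - prob ?cov \<le> prob \<A> + prob \<B> + prob \<C> + \<alpha>"
    using D(2) prob_compl[OF cov] by simp
  moreover have "1 - \<alpha> - 2 * (r + s + t) \<le> q"
    if "1 - q \<le> r + s + t + \<alpha>" "0 \<le> r" "0 \<le> s" "0 \<le> t" for q r s t :: real
    using that by argo
  ultimately show ?thesis
    using measure_nonneg by blast
qed

end
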